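(* Let $D$ be a symmetric slice domain in $\mathbb{H}$, let $\mathcal{M}_s(D)^{\times}$ be the multiplicative group of the field $\mathcal{M}_s(D)$, and let $\Gamma:\mathcal{M}_s(D)^{\times}\to\mathrm{Div}(D)$ be the map sending $f$ to the principal spherical divisor $\mathrm{div}(f)$. Then: (i) $\Gamma$ is a group homomorphism; (ii) $f\in\mathcal{M}_s(D)^{\times}$ is regular in $D$ if and only if $\mathrm{div}(f)\ge0$; (iii) $f\in\mathcal{M}_s(D)^{\times}$ is a unit in $\mathcal{O}_s(D)$ if and only if $\mathrm{div}(f)=0$.
   Context: $\mathbb{H}$ denotes the real quaternions, $\mathbb{S}=\{I\in\mathbb{H}: I^2=-1\}$, and for $I\in\mathbb{S}$, $\mathbb{C}_I=\mathbb{R}+I\mathbb{R}$. For $x,y\in\mathbb{R}$, $[x+y\mathbb{S}]=\{x+yJ:J\in\mathbb{S}\}$ (the singleton $\{x\}$ if $y=0$). A domain is a nonempty connected open subset of $\mathbb{H}\cong\mathbb{R}^4$ (resp. of $\mathbb{C}_I$). A symmetric slice domain is a domain $D\subset\mathbb{H}$ such that $D\cap\mathbb{R}\neq\emptyset$, $D\cap\mathbb{C}_I$ is a domain in $\mathbb{C}_I$ for every $I\in\mathbb{S}$, and $[x+y\mathbb{S}]\subset D$ whenever $x+Iy\in D$ ($x,y\in\mathbb{R}$, $I\in\mathbb{S}$). A function $f:D\to\mathbb{H}$ is regular if for every $I\in\mathbb{S}$ its restriction $f_I$ to $D\cap\mathbb{C}_I$ has continuous partial derivatives and satisfies $\frac12\left(\frac{\partial}{\partial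 x}+I\frac{\partial}{\partial y}\right)f_I(x+Iy)=0$ for all $x+Iy\in D\cap\mathbb{C}_I$. A regular $f$ is slice preserving if $f(D\cap\mathbb{C}_I)\subset\mathbb{C}_I$ for every $I\in\mathbb{S}$. $\mathcal{O}_s(D)$ is the integral domain of slice preserving regular functions on $D$ with pointwise operations. Singularities: let $f$ be regular on a symmetric slice domain $A$. A point $p\in\mathbb{C}_I$ is a singularity of $f$ if $A$ contains $\{z\in\mathbb{C}_I:0<|z-p|<R\}$ for some $R>0$; on this set $f(z)=\sum_{n\in\mathbb{Z}}(z-p)^n a_n$ with unique $a_n\in\mathbb{H}$. The singularity is removable if $f$ extends to a regular function on a neighborhood of $p$; a nonremovable singularity is a pole if there is an integer $\ell\ge0$ with $a_{-n}=0$ for all $n>\ell$. A slice preserving semiregular function on $D$ is a function $f$ which is slice preserving regular on some symmetric slice domain $A\subset D$ and such that every point of $D\setminus A$ is a pole or a removable singularity of $f$. $\mathcal{M}_s(D)$ is the set of these functions (two being identified if they agree where both are regular, removable singularities being filled in); it is a field under pointwise addition and multiplication. Spherical order: for $f\in\mathcal{M}_s(D)$, $f\not\equiv0$, and $p=x+Iy\in D$, the spherical order $\mathrm{sord}_f(p)$ is the unique integer $\ell$ such that, for some slice preserving semiregular function $g$ on $D$ with neither poles nor zeros in $[x+y\mathbb{S}]$, $f(q)=((q-x)^2+y^2)^{\ell}g(q)$ if $y\neq0$, and $f(q)=(q-x)^{\ell}g(q)$ if $y=0$ (such a unique integer exists). Spherical divisors: write $D$ as the disjoint union of its spheres $\mathbb{S}_i=[x_i+y_i\mathbb{S}]$,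 $i\in\mathcal{I}$. A spherical divisor on $D$ is a map $\mathfrak{d}:D\to\mathbb{Z}$ that is constant on each $\mathbb{S}_i$ and such that every $q\in D$ has a neighborhood $U_q\subset D$ which is a symmetric slice domain and for which only finitely many $\mathbb{S}_i$ have $\mathfrak{d}$ nonzero on $U_q\cap\mathbb{S}_i$. $\mathrm{Div}(D)$ is the abelian group of spherical divisors under pointwise addition; $\mathfrak{d}\ge0$ means $\mathfrak{d}(q)\ge0$ for all $q\in D$. For $f\in\mathcal{M}_s(D)^\times$, $\mathrm{div}(f)$ is the spherical divisor $q\mapsto\mathrm{sord}_f(q)$. *)

theory Defs
  imports "HOL-Analysis.Analysis" "HOL-Algebra.Multiplicative_Group"
begin

section \<open>The real quaternions\<close>

datatype quat = Quat (qre: real) (qim1: real) (qim2: real) (qim3: real)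

lemma quat_eq_iff:
  "p = q \<longleftrightarrow> qre p = qre q \<and> qim1 p = qim1 q \<and> qim2 p = qim2 q \<and> qim3 p = qim3 q"
  by (cases p; cases q) simp

instantiation quat :: ab_group_add
begin

definition zero_quat :: quat where "0 = Quat 0 0 0 0"
definition plus_quat :: "quat \<Rightarrow> quat \<Rightarrow> quat" where
  "p + q = Quat (qre p + qre q) (qim1 p + qim1 q) (qim2 p + qim2 q) (qim3 p + qim3 q)"
definition uminus_quat :: "quat \<Rightarrow> quat" where
  "- p = Quat (- qre p) (- qim1 p) (- qim2 p) (- qim3 p)"
definition minus_quat :: "quat \<Rightarrow> quat \<Rightarrow> quat" where
  "p - q = Quat (qre p - qre q) (qim1 p - qim1 q) (qim2 p - qim2 q) (qim3 p - qim3 q)"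

instance
  by standard
    (simp_all add: quat_eq_iff zero_quat_def plus_quat_def uminus_quat_def minus_quat_def)

end

lemma quat_add_simps [simp]:
  "qre 0 = 0" "qim1 0 = 0" "qim2 0 = 0" "qim3 0 = 0"
  "qre (p + q) = qre p + qre q" "qim1 (p + q) = qim1 p + qim1 q"
  "qim2 (p + q) = qim2 p + qim2 q" "qim3 (p + q) = qim3 p + qim3 q"
  "qre (- p) = - qre p" "qim1 (- p) = - qim1 p"
  "qim2 (- p) = - qim2 p" "qim3 (- p) = - qim3 p"
  "qre (p - q) = qre p - qre q" "qim1 (p - q) = qim1 p - qim1 q"
  "qim2 (p - q) = qim2 p - qim2 q" "qim3 (p - q) = qim3 p - qim3 q"
  by (simp_all add: zero_quat_def plus_quat_def uminus_quat_def minus_quat_def)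

instantiation quat :: real_vector
begin

definition scaleR_quat :: "real \<Rightarrow> quat \<Rightarrow> quat" where
  "r *\<^sub>R p = Quat (r * qre p) (r * qim1 p) (r * qim2 p) (r * qim3 p)"

instance
  by standard (simp_all add: quat_eq_iff scaleR_quat_def algebra_simps)

end

lemma quat_scaleR_simps [simp]:
  "qre (r *\<^sub>R p) = r * qre p" "qim1 (r *\<^sub>R p) = r * qim1 p"
  "qim2 (r *\<^sub>R p) = r * qim2 p" "qim3 (r *\<^sub>R p) = r * qim3 p"
  by (simp_all add: scaleR_quat_def)

instantiation quat :: real_normed_vector
begin

definition norm_quat_def:
  "norm p = sqrt ((qre p)\<^sup>2 + (qim1 p)\<^sup>2 + (qim2 p)\<^sup>2 + (qim3 p)\<^sup>2)" for p :: quat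
definition sgn_quat_def:
  "sgn p = p /\<^sub>R norm p" for p :: quat
definition dist_quat_def:
  "dist p q = norm (p - q)" for p q :: quat
definition uniformity_quat_def:
  "(uniformity :: (quat \<times> quat) filter) = (INF e\<in>{0 <..}. principal {(p, q). dist p q < e})"
definition open_quat_def:
  "open (U :: quat set) \<longleftrightarrow> (\<forall>p\<in>U. eventually (\<lambda>(p', q). p' = p \<longrightarrow> q \<in> U) uniformity)"

instance
proof
  fix p q :: quat and r :: real
  have np: "norm s = norm ((qre s, qim1 s), (qim2 s, qim3 s))" for s :: quat
    by (simp add: norm_quat_def norm_prod_def)
  show "norm p = 0 \<longleftrightarrow> p = 0"
    by (simp add: np quat_eq_iff zero_prod_def)
  show "norm (p + q) \<le> norm p + norm q"
    using norm_triangle_ineq [of "((qre p, qim1 p), (qim2 p, qim3 p))"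
        "((qre q, qim1 q), (qim2 q, qim3 q))"]
    by (simp add: np)
  show "norm (r *\<^sub>R p) = \<bar>r\<bar> * norm p"
    using norm_scaleR [of r "((qre p, qim1 p), (qim2 p, qim3 p))"]
    by (simp add: np)
qed (simp_all add: sgn_quat_def dist_quat_def uniformity_quat_def open_quat_def)

end

instantiation quat :: real_algebra_1
begin

definition one_quat :: quat where "1 = Quat 1 0 0 0"
definition times_quat :: "quat \<Rightarrow> quat \<Rightarrow> quat" where
  "p * q = Quat
     (qre p * qre q - qim1 p * qim1 q - qim2 p * qim2 q - qim3 p * qim3 q)
     (qre p * qim1 q + qim1 p * qre q + qim2 p * qim3 q - qim3 p * qim2 q)
     (qre p * qim2 q - qim1 p * qim3 q + qim2 p * qre q + qim3 p * qim1 q)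
     (qre p * qim3 q + qim1 p * qim2 q - qim2 p * qim1 q + qim3 p * qre q)"

instance
  by standard (simp_all add: quat_eq_iff times_quat_def one_quat_def algebra_simps)

end

lemma quat_mult_simps [simp]:
  "qre 1 = 1" "qim1 1 = 0" "qim2 1 = 0" "qim3 1 = 0"
  "qre (p * q) = qre p * qre q - qim1 p * qim1 q - qim2 p * qim2 q - qim3 p * qim3 q"
  "qim1 (p * q) = qre p * qim1 q + qim1 p * qre q + qim2 p * qim3 q - qim3 p * qim2 q"
  "qim2 (p * q) = qre p * qim2 q - qim1 p * qim3 q + qim2 p * qre q + qim3 p * qim1 q"
  "qim3 (p * q) = qre p * qim3 q + qim1 p * qim2 q - qim2 p * qim1 q + qim3 p * qre q"
  by (simp_all add: one_quat_def times_quat_def)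

instantiation quat :: real_normed_div_algebra
begin

definition inverse_quat :: "quat \<Rightarrow> quat" where
  "inverse p = Quat (qre p) (- qim1 p) (- qim2 p) (- qim3 p) /\<^sub>R (norm p)\<^sup>2"
definition divide_quat :: "quat \<Rightarrow> quat \<Rightarrow> quat" where
  "p div q = p * inverse q" for p q :: quat

instance
proof
  fix p q :: quat
  show "p div q = p * inverse q" by (rule divide_quat_def)
  show "inverse (0::quat) = 0" by (simp add: inverse_quat_def)
  have n2: "(norm s)\<^sup>2 = (qre s)\<^sup>2 + (qim1 s)\<^sup>2 + (qim2 s)\<^sup>2 + (qim3 s)\<^sup>2" for s :: quat
    by (simp add: norm_quat_def)
  have "(norm (p * q))\<^sup>2 = (norm p * norm q)\<^sup>2"
    unfolding power_mult_distrib n2 quat_mult_simps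
    by (simp add: power2_eq_square algebra_simps)
  then show "norm (p * q) = norm p * norm q"
    by (rule power2_eq_imp_eq) simp_all
  assume "p \<noteq> 0"
  then have nz: "(norm p)\<^sup>2 \<noteq> 0" by simp
  let ?c = "Quat (qre p) (- qim1 p) (- qim2 p) (- qim3 p)"
  have "?c * p = (norm p)\<^sup>2 *\<^sub>R 1" "p * ?c = (norm p)\<^sup>2 *\<^sub>R 1"
    unfolding n2 by (simp_all add: quat_eq_iff power2_eq_square)
  moreover have "inverse p * p = (?c * p) /\<^sub>R (norm p)\<^sup>2" "p * inverse p = (p * ?c) /\<^sub>R (norm p)\<^sup>2"
    unfolding inverse_quat_def by (rule mult_scaleR_left, rule mult_scaleR_right)
  ultimately show "inverse p * p = 1" "p * inverse p = 1"
    using nz by simp_all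
qed

end

instantiation quat :: real_inner
begin

definition inner_quat_def:
  "inner p q = qre p * qre q + qim1 p * qim1 q + qim2 p * qim2 q + qim3 p * qim3 q" for p q :: quat

instance
proof
  fix p q s :: quat and r :: real
  show "inner p q = inner q p" "inner (p + q) s = inner p s + inner q s"
    "inner (r *\<^sub>R p) q = r * inner p q"
    by (simp_all add: inner_quat_def algebra_simps)
  show n: "norm p = sqrt (inner p p)"
    by (simp add: norm_quat_def inner_quat_def power2_eq_square)
  show ge: "0 \<le> inner p p"
    by (simp add: inner_quat_def)
  show "inner p p = 0 \<longleftrightarrow> p = 0"
    using norm_eq_zero [of p] unfolding n by simp
qed

end

instantiation quat :: euclidean_space
begin

definition Basis_quat :: "quat set" where
  "Basis = {Quat 1 0 0 0, Quat 0 1 0 0, Quat 0 0 1 0, Quat 0 0 0 1}"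

instance
proof
  fix u v :: quat
  show "inner u v = (if u = v then 1 else 0)" if "u \<in> Basis" "v \<in> Basis"
    using that unfolding Basis_quat_def by (elim insertE) (simp_all add: inner_quat_def)
  show "(\<forall>v\<in>Basis. inner u v = 0) \<longleftrightarrow> u = 0"
    by (simp add: Basis_quat_def inner_quat_def quat_eq_iff [of u 0])
qed (simp_all add: Basis_quat_def)

end


section \<open>Slices and symmetric slice domains\<close>

definition imag_units :: "quat set" where
  "imag_units = {I. I\<^sup>2 = -1}"

definition spt :: "quat \<Rightarrow> real \<Rightarrow> real \<Rightarrow> quat" where
  "spt I x y = of_real x + I * of_real y"

definition slice :: "quat \<Rightarrow> quat set" where
  "slice I = {spt I x y | x y. True}"

definition sphere_at :: "real \<Rightarrow> real \<Rightarrow> quat set" where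
  "sphere_at x y = {spt J x y | J. J \<in> imag_units}"

definition domain_in :: "'a::topological_space set \<Rightarrow> 'a set \<Rightarrow> bool" where
  "domain_in X D \<longleftrightarrow> D \<noteq> {} \<and> connected D \<and> openin (top_of_set X) D"

definition symmetric_slice_domain :: "quat set \<Rightarrow> bool" where
  "symmetric_slice_domain D \<longleftrightarrow>
     domain_in UNIV D \<and>
     D \<inter> range of_real \<noteq> {} \<and>
     (\<forall>I\<in>imag_units. domain_in (slice I) (D \<inter> slice I)) \<and>
     (\<forall>I\<in>imag_units. \<forall>x y. spt I x y \<in> D \<longrightarrow> sphere_at x y \<subseteq> D)"


section \<open>Regular and slice preserving functions\<close>

text \<open>Only the values of \<^term>\<open>f\<close> on the open set \<^term>\<open>D\<close> matter; \<^term>\<open>fx\<close> and \<^term>\<open>fy\<close> are the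
  partial derivatives of \<^term>\<open>\<lambda>x y. f (spt I x y)\<close>.\<close>

definition regular_on :: "quat set \<Rightarrow> (quat \<Rightarrow> quat) \<Rightarrow> bool" where
  "regular_on D f \<longleftrightarrow>
     (\<forall>I\<in>imag_units. \<exists>fx fy.
        continuous_on {(x, y). spt I x y \<in> D} (\<lambda>(x, y). fx x y) \<and>
        continuous_on {(x, y). spt I x y \<in> D} (\<lambda>(x, y). fy x y) \<and>
        (\<forall>x y. spt I x y \<in> D \<longrightarrow>
           ((\<lambda>t. f (spt I t y)) has_vector_derivative fx x y) (at x) \<and>
           ((\<lambda>t. f (spt I x t)) has_vector_derivative fy x y) (at y) \<and>
           (1/2) *\<^sub>R (fx x y + I * fy x y) = 0))"

definition slice_preserving_on :: "quat set \<Rightarrow> (quat \<Rightarrow> quat) \<Rightarrow> bool" where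
  "slice_preserving_on D f \<longleftrightarrow>
     regular_on D f \<and> (\<forall>I\<in>imag_units. f ` (D \<inter> slice I) \<subseteq> slice I)"

text \<open>Functions on \<^term>\<open>D\<close> are represented by their extensional extensions to the whole type.\<close>

definition Os :: "quat set \<Rightarrow> (quat \<Rightarrow> quat) ring" where
  "Os D = \<lparr>carrier = {f \<in> extensional D. slice_preserving_on D f},
           mult = (\<lambda>f g. \<lambda>q\<in>D. f q * g q), one = (\<lambda>q\<in>D. 1),
           zero = (\<lambda>q\<in>D. 0), add = (\<lambda>f g. \<lambda>q\<in>D. f q + g q)\<rparr>"


section \<open>Singularities and semiregular functions\<close>

definition punctured_disc :: "quat \<Rightarrow> quat \<Rightarrow> real \<Rightarrow> quat set" where
  "punctured_disc I p R = {z \<in> slice I. 0 < norm (z - p) \<and> norm (z - p) < R}"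

definition singularity_in :: "quat \<Rightarrow> quat set \<Rightarrow> quat \<Rightarrow> bool" where
  "singularity_in I A p \<longleftrightarrow> p \<in> slice I \<and> (\<exists>R>0. punctured_disc I p R \<subseteq> A)"

definition removable_at :: "quat set \<Rightarrow> (quat \<Rightarrow> quat) \<Rightarrow> quat \<Rightarrow> bool" where
  "removable_at A f p \<longleftrightarrow>
     (\<exists>U g. open U \<and> p \<in> U \<and> regular_on U g \<and> (\<forall>q\<in>U \<inter> A. g q = f q))"

definition removable_sing :: "quat \<Rightarrow> quat set \<Rightarrow> (quat \<Rightarrow> quat) \<Rightarrow> quat \<Rightarrow> bool" where
  "removable_sing I A f p \<longleftrightarrow> singularity_in I A p \<and> removable_at A f p"

text \<open>The coefficients \<^term>\<open>a\<close> of the Laurent expansion are unique, so quantifying them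
  existentially refers to the Laurent expansion of \<^term>\<open>f\<close> at \<^term>\<open>p\<close>.\<close>

definition pole_sing :: "quat \<Rightarrow> quat set \<Rightarrow> (quat \<Rightarrow> quat) \<Rightarrow> quat \<Rightarrow> bool" where
  "pole_sing I A f p \<longleftrightarrow>
     singularity_in I A p \<and> \<not> removable_at A f p \<and>
     (\<exists>R>0. \<exists>a :: int \<Rightarrow> quat.
        punctured_disc I p R \<subseteq> A \<and>
        (\<forall>z\<in>punctured_disc I p R. ((\<lambda>n. (z - p) powi n * a n) has_sum f z) UNIV) \<and>
        (\<exists>l\<ge>0. \<forall>n>l. a (- n) = 0))"

text \<open>A semiregular function is first given by a pair of a symmetric slice domain and a function
  whose values outside that domain are irrelevant; elements of \<open>Ms D\<close> are classes of such pairs.\<close>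

definition semireg_pairs :: "quat set \<Rightarrow> (quat set \<times> (quat \<Rightarrow> quat)) set" where
  "semireg_pairs D =
     {(A, f). symmetric_slice_domain A \<and> A \<subseteq> D \<and> slice_preserving_on A f \<and>
        (\<forall>p\<in>D - A. \<exists>I\<in>imag_units. pole_sing I A f p \<or> removable_sing I A f p)}"

definition semireg_rel ::
    "quat set \<Rightarrow> ((quat set \<times> (quat \<Rightarrow> quat)) \<times> (quat set \<times> (quat \<Rightarrow> quat))) set" where
  "semireg_rel D =
     {((A, f), (B, g)). (A, f) \<in> semireg_pairs D \<and> (B, g) \<in> semireg_pairs D \<and>
        (\<forall>q\<in>A \<inter> B. f q = g q)}"

type_synonym semireg = "(quat set \<times> (quat \<Rightarrow> quat)) set"

definition semireg_class :: "quat set \<Rightarrow> quat set \<Rightarrow> (quat \<Rightarrow> quat) \<Rightarrow> semireg" where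
  "semireg_class D A f = semireg_rel D `` {(A, f)}"

definition Ms :: "quat set \<Rightarrow> semireg ring" where
  "Ms D = \<lparr>carrier = semireg_pairs D // semireg_rel D,
           mult = (\<lambda>F G. \<Union>(A, f)\<in>F. \<Union>(B, g)\<in>G. semireg_class D (A \<inter> B) (\<lambda>q. f q * g q)),
           one = semireg_class D D (\<lambda>q. 1),
           zero = semireg_class D D (\<lambda>q. 0),
           add = (\<lambda>F G. \<Union>(A, f)\<in>F. \<Union>(B, g)\<in>G. semireg_class D (A \<inter> B) (\<lambda>q. f q + g q))\<rparr>"

text \<open>Regularity of a semiregular function on all of \<^term>\<open>D\<close>, removable singularities being
  filled in.\<close>

definition regular_in :: "quat set \<Rightarrow> semireg \<Rightarrow> bool" where
  "regular_in D F \<longleftrightarrow> (\<exists>h. regular_on D h \<and> (\<forall>(A, f)\<in>F. \<forall>q\<in>A. h q = f q))"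

text \<open>Being a unit of \<open>Os D\<close>, regarded as a subring of \<open>Ms D\<close>.\<close>

definition unit_in_Os :: "quat set \<Rightarrow> semireg \<Rightarrow> bool" where
  "unit_in_Os D F \<longleftrightarrow> (\<exists>u\<in>Units (Os D). F = semireg_class D D u)"


section \<open>Spherical order and spherical divisors\<close>

definition sphere_poly :: "real \<Rightarrow> real \<Rightarrow> quat \<Rightarrow> quat" where
  "sphere_poly x y q =
     (if y = 0 then q - of_real x else (q - of_real x)\<^sup>2 + (of_real y)\<^sup>2)"

text \<open>The function \<^term>\<open>g\<close> has no pole on the sphere iff, once removable singularities are filled
  in, it has a representative whose domain \<^term>\<open>B\<close> contains the sphere. The factorization is an
  identity of semiregular functions, hence it is only required where both sides are defined.\<close>

definition is_sord :: "quat set \<Rightarrow> semireg \<Rightarrow> quat \<Rightarrow> int \<Rightarrow> bool" where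
  "is_sord D F p l \<longleftrightarrow>
     (\<exists>I\<in>imag_units. \<exists>x y. p = spt I x y \<and>
       (\<exists>(A, f)\<in>F. \<exists>(B, g)\<in>semireg_pairs D.
          sphere_at x y \<subseteq> B \<and> (\<forall>q\<in>sphere_at x y. g q \<noteq> 0) \<and>
          (\<forall>q\<in>A \<inter> B - sphere_at x y. f q = sphere_poly x y q powi l * g q)))"

definition sord :: "quat set \<Rightarrow> semireg \<Rightarrow> quat \<Rightarrow> int" where
  "sord D F p = (THE l. is_sord D F p l)"

definition spheres_of :: "quat set \<Rightarrow> quat set set" where
  "spheres_of D = {sphere_at x y | x y. sphere_at x y \<subseteq> D}"

definition spherical_divisor :: "quat set \<Rightarrow> (quat \<Rightarrow> int) \<Rightarrow> bool" where
  "spherical_divisor D d \<longleftrightarrow>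
     (\<forall>S\<in>spheres_of D. \<forall>p\<in>S. \<forall>q\<in>S. d p = d q) \<and>
     (\<forall>q\<in>D. \<exists>U. q \<in> U \<and> U \<subseteq> D \<and> symmetric_slice_domain U \<and>
        finite {S \<in> spheres_of D. \<exists>p\<in>U \<inter> S. d p \<noteq> 0})"

definition Div :: "quat set \<Rightarrow> (quat \<Rightarrow> int) monoid" where
  "Div D = \<lparr>carrier = {d \<in> extensional D. spherical_divisor D d},
            mult = (\<lambda>d e. \<lambda>q\<in>D. d q + e q), one = (\<lambda>q\<in>D. 0)\<rparr>"

definition principal_div :: "quat set \<Rightarrow> semireg \<Rightarrow> (quat \<Rightarrow> int)" where
  "principal_div D F = (\<lambda>q\<in>D. sord D F q)"

end

theory Submission
  imports Defs "HOL-Complex_Analysis.Complex_Analysis"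
begin

text \<open>
  The statement reduces to the calculus of orders of meromorphic functions of one complex variable.

  Each sphere \<open>x + y\<S>\<close> with \<open>y \<noteq> 0\<close> meets every slice in a pair of conjugate points, so a
  symmetric slice domain \<open>D\<close> is the rotation of a conjugation invariant plane domain,
  \<open>slice_trace D\<close>, which meets the real axis. A slice preserving regular function is holomorphic on
  each slice, and at a real point its value lies in all slices, hence is real. By the identity
  theorem the functions induced on the different slices coincide: there is one holomorphic \<open>F\<close> on
  \<open>slice_trace D\<close>, the stem function, with \<open>F (cnj z) = cnj (F z)\<close>
  (\<open>slice_preserving_imp_stem\<close>). Conversely, rotating such an \<open>F\<close> gives a slice preserving regular
  function (\<open>stem_imp_slice_preserving\<close>).

  The orthogonal projection of the quaternions to a slice \<open>\<complex>\<^sub>I\<close> is linear over \<open>\<complex>\<^sub>I\<close> acting from the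
  left, so it maps quaternionic Laurent expansions to complex ones. Therefore the poles and
  removable singularities of a slice preserving function are exactly the nonessential singularities
  of its stem function, and elements of \<open>Ms D\<close> correspond to conjugation symmetric meromorphic
  functions on \<open>slice_trace D\<close>, identified when they agree near every point
  (\<open>semireg_pairs_imp_meromorphic_stem\<close>, \<open>meromorphic_stem_imp_semireg_pairs\<close>, \<open>semireg_rel_iff\<close>).
  Products and inverses require smaller domains of definition. These are again symmetric slice
  domains, because deleting a closed discrete set does not disconnect a plane domain.

  The stem function of the polynomial of a sphere has simple zeros at the points that represent the
  sphere, so the spherical order is the order of the stem function at any of them
  (\<open>sord_eq_zorder\<close>). This gives the three claims: orders are additive; a meromorphic function
  without negative orders has no poles and becomes holomorphic after its removable singularities
  are filled in; if all orders vanish, the function obtained in this way has no zeros, and its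
  reciprocal is holomorphic as well.

  That the order function is a spherical divisor needs one more argument, since the neighborhoods
  in the definition of a divisor must reach the real axis: such a neighborhood is found by
  thickening a path from the given point to a real point, and compactness of the path makes the
  support finite (\<open>sphere_nbhd_finite_support\<close>, \<open>spherical_divisor_iff\<close>).
\<close>

section \<open>Slices as copies of the complex plane\<close>

lemma quat_of_real_simps [simp]:
  "qre (of_real r) = r" "qim1 (of_real r) = 0" "qim2 (of_real r) = 0" "qim3 (of_real r) = 0"
  by (simp_all add: of_real_def)

lemma imag_units_iff:
  "I \<in> imag_units \<longleftrightarrow> qre I = 0 \<and> (qim1 I)\<^sup>2 + (qim2 I)\<^sup>2 + (qim3 I)\<^sup>2 = 1"
proof
  assume I: "I \<in> imag_units"
  then have e: "I * I = -1"
    by (simp add: imag_units_def power2_eq_square)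
  have eqs: "qre I * qre I - qim1 I * qim1 I - qim2 I * qim2 I - qim3 I * qim3 I = -1"
    "2 * (qre I * qim1 I) = 0" "2 * (qre I * qim2 I) = 0" "2 * (qre I * qim3 I) = 0"
    using arg_cong [OF e, of qre] arg_cong [OF e, of qim1] arg_cong [OF e, of qim2]
      arg_cong [OF e, of qim3] by (simp_all add: mult.commute)
  have "qre I = 0"
  proof (rule ccontr)
    assume "qre I \<noteq> 0"
    then have "qre I * qre I = -1"
      using eqs by simp
    then show False
      by (metis neg_0_le_iff_le not_one_le_zero zero_le_square)
  qed
  then show "qre I = 0 \<and> (qim1 I)\<^sup>2 + (qim2 I)\<^sup>2 + (qim3 I)\<^sup>2 = 1"
    using eqs by (simp add: power2_eq_square)
qed (simp add: imag_units_def quat_eq_iff power2_eq_square algebra_simps)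

lemma uminus_imag_unit: "I \<in> imag_units \<Longrightarrow> - I \<in> imag_units"
  by (simp add: imag_units_iff)

text \<open>
  For an imaginary unit \<open>I\<close> this is the isometric ring isomorphism from the complex numbers to the
  slice of \<open>I\<close> that maps \<open>\<i>\<close> to \<open>I\<close>.
\<close>
definition emb :: "quat \<Rightarrow> complex \<Rightarrow> quat" where
  "emb I z = spt I (Re z) (Im z)"

lemma spt_eq_emb: "spt I x y = emb I (Complex x y)"
  by (simp add: emb_def)

lemma emb_components:
  assumes "I \<in> imag_units"
  shows "qre (emb I z) = Re z" "qim1 (emb I z) = qim1 I * Im z"
    "qim2 (emb I z) = qim2 I * Im z" "qim3 (emb I z) = qim3 I * Im z"
  using assms by (simp_all add: emb_def spt_def imag_units_iff)

lemma emb_simps [simp]: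
  "emb I 0 = 0" "emb I 1 = 1" "emb I (of_real x) = of_real x"
  "emb I (z + w) = emb I z + emb I w" "emb I (- z) = - emb I z" "emb I (z - w) = emb I z - emb I w"
  "emb I (r *\<^sub>R z) = r *\<^sub>R emb I z"
  by (simp_all add: emb_def spt_def algebra_simps of_real_def)

lemma emb_mult:
  assumes "I \<in> imag_units"
  shows "emb I (z * w) = emb I z * emb I w"
proof -
  have s: "(qim3 I)\<^sup>2 = 1 - (qim1 I)\<^sup>2 - (qim2 I)\<^sup>2"
    using assms by (simp add: imag_units_iff)
  have "qim1 I * Im z * (qim1 I * Im w) + qim2 I * Im z * (qim2 I * Im w)
      + qim3 I * Im z * (qim3 I * Im w) = Im z * Im w * ((qim1 I)\<^sup>2 + (qim2 I)\<^sup>2 + (qim3 I)\<^sup>2)"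
    by (simp add: power2_eq_square algebra_simps)
  then show ?thesis
    using assms s by (simp add: quat_eq_iff emb_components algebra_simps)
qed

lemma emb_power: "I \<in> imag_units \<Longrightarrow> emb I (z ^ n) = emb I z ^ n"
  by (induction n) (simp_all add: emb_mult)

lemma norm_emb:
  assumes "I \<in> imag_units"
  shows "norm (emb I z) = norm z"
proof -
  have "(qim1 I * Im z)\<^sup>2 + (qim2 I * Im z)\<^sup>2 + (qim3 I * Im z)\<^sup>2
      = ((qim1 I)\<^sup>2 + (qim2 I)\<^sup>2 + (qim3 I)\<^sup>2) * (Im z)\<^sup>2"
    by (simp add: power_mult_distrib algebra_simps)
  also have "(qim1 I)\<^sup>2 + (qim2 I)\<^sup>2 + (qim3 I)\<^sup>2 = 1"
    using assms by (simp only: imag_units_iff)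
  finally show ?thesis
    by (simp add: norm_quat_def cmod_def emb_components [OF assms] add.assoc)
qed

lemma emb_eq_0_iff: "I \<in> imag_units \<Longrightarrow> emb I z = 0 \<longleftrightarrow> z = 0"
  using norm_emb [of I z] by (metis norm_eq_zero)

lemma emb_eq_iff: "I \<in> imag_units \<Longrightarrow> emb I z = emb I w \<longleftrightarrow> z = w"
  using emb_eq_0_iff [of I "z - w"] by simp

lemma emb_inverse:
  assumes "I \<in> imag_units"
  shows "emb I (inverse z) = inverse (emb I z)"
proof (cases "z = 0")
  case False
  then have "emb I z * emb I (inverse z) = 1"
    using assms by (simp flip: emb_mult)
  then show ?thesis
    by (metis inverse_unique)
qed simp

lemma emb_powi: "I \<in> imag_units \<Longrightarrow> emb I (z powi n) = emb I z powi n"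
  by (simp add: power_int_def emb_power emb_inverse)

lemma emb_uminus_unit: "emb (- I) z = emb I (cnj z)"
  by (simp add: emb_def spt_def)

lemma bounded_linear_emb:
  assumes "I \<in> imag_units"
  shows "bounded_linear (emb I)"
  by (rule bounded_linear_intro [where K = 1]) (simp_all add: norm_emb assms)

lemma continuous_emb: "I \<in> imag_units \<Longrightarrow> continuous_on S (emb I)"
  by (rule linear_continuous_on) (rule bounded_linear_emb)

lemma mem_slice_iff: "q \<in> slice I \<longleftrightarrow> (\<exists>z. q = emb I z)"
  unfolding slice_def spt_eq_emb mem_Collect_eq by (metis complex_surj)

lemma emb_in_slice [simp]: "emb I z \<in> slice I"
  by (auto simp: mem_slice_iff)

text \<open>
  For an imaginary unit \<open>I\<close> this is the orthogonal projection to the slice of \<open>I\<close>, read as a complex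
  number; on the slice it inverts \<open>emb I\<close>.
\<close>
definition slice_coord :: "quat \<Rightarrow> quat \<Rightarrow> complex" where
  "slice_coord I q = Complex (qre q) (inner I q)"

lemma bounded_linear_slice_coord: "bounded_linear (slice_coord I)"
proof -
  have "slice_coord I q = of_real (inner 1 q) + \<i> * of_real (inner I q)" for q
    by (simp add: complex_eq_iff slice_coord_def inner_quat_def)
  then have eq: "slice_coord I = (\<lambda>q. of_real (inner 1 q) + \<i> * of_real (inner I q))"
    by auto
  show ?thesis
    unfolding eq
    by (intro bounded_linear_add bounded_linear_const_mult
        bounded_linear_compose [OF bounded_linear_of_real] bounded_linear_inner_right)
qed

text \<open>
  Left multiplication by an element of a slice preserves the slice and its orthogonal complement.
  The order of the factors is the one in the terms \<open>(z - p) powi n * a n\<close> of a Laurent expansion,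
  so that arbitrary quaternionic coefficients can be projected to complex ones.
\<close>
lemma slice_coord_emb_mult:
  assumes "I \<in> imag_units"
  shows "slice_coord I (emb I w * a) = w * slice_coord I a"
proof -
  have s: "qim1 I * qim1 I + qim2 I * qim2 I + qim3 I * qim3 I = 1" "qre I = 0"
    using assms by (auto simp: imag_units_iff power2_eq_square)
  have "qim1 I * (qim1 I * Im w * qre a) + qim2 I * (qim2 I * Im w * qre a)
      + qim3 I * (qim3 I * Im w * qre a)
      = (qim1 I * qim1 I + qim2 I * qim2 I + qim3 I * qim3 I) * (Im w * qre a)"
    by (simp add: algebra_simps)
  then have "qim1 I * (qim1 I * Im w * qre a) + qim2 I * (qim2 I * Im w * qre a)
      + qim3 I * (qim3 I * Im w * qre a) = Im w * qre a"
    using s by simp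
  then show ?thesis
    using s assms
    by (simp add: complex_eq_iff slice_coord_def inner_quat_def emb_components algebra_simps)
qed

lemma slice_coord_1: "I \<in> imag_units \<Longrightarrow> slice_coord I 1 = 1"
  by (simp add: complex_eq_iff slice_coord_def inner_quat_def imag_units_iff)

lemma slice_coord_emb [simp]: "I \<in> imag_units \<Longrightarrow> slice_coord I (emb I w) = w"
  using slice_coord_emb_mult [of I w 1] by (simp add: slice_coord_1)

lemma emb_slice_coord: "I \<in> imag_units \<Longrightarrow> q \<in> slice I \<Longrightarrow> emb I (slice_coord I q) = q"
  by (auto simp: mem_slice_iff)

definition quat_i :: quat where "quat_i = Quat 0 1 0 0"
definition quat_j :: quat where "quat_j = Quat 0 0 1 0"

lemma quat_ij_units [simp]: "quat_i \<in> imag_units" "quat_j \<in> imag_units"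
  by (simp_all add: imag_units_iff quat_i_def quat_j_def)

lemma slice_i_Int_slice_j: "q \<in> slice quat_i \<Longrightarrow> q \<in> slice quat_j \<Longrightarrow> q = of_real (qre q)"
  by (auto simp: mem_slice_iff quat_eq_iff emb_components)
    (auto simp: quat_i_def quat_j_def)

text \<open>
  The point of the closed upper half plane that represents the sphere through \<open>q\<close>.
\<close>
definition sphere_coord :: "quat \<Rightarrow> complex" where
  "sphere_coord q = Complex (qre q) (sqrt ((qim1 q)\<^sup>2 + (qim2 q)\<^sup>2 + (qim3 q)\<^sup>2))"

lemma sphere_coord_emb:
  assumes "I \<in> imag_units"
  shows "sphere_coord (emb I z) = Complex (Re z) \<bar>Im z\<bar>"
proof -
  have "(qim1 I * Im z)\<^sup>2 + (qim2 I * Im z)\<^sup>2 + (qim3 I * Im z)\<^sup>2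
      = (Im z)\<^sup>2 * ((qim1 I)\<^sup>2 + (qim2 I)\<^sup>2 + (qim3 I)\<^sup>2)"
    by (simp add: power_mult_distrib algebra_simps)
  then show ?thesis
    using assms by (simp add: sphere_coord_def emb_components imag_units_iff)
qed

lemma sphere_coord_emb_cases:
  assumes "I \<in> imag_units"
  obtains "sphere_coord (emb I z) = z" | "sphere_coord (emb I z) = cnj z"
  using sphere_coord_emb [OF assms, of z] by (cases "Im z \<ge> 0") (auto simp: complex_eq_iff)

lemma ex_unit_sphere_coord:
  obtains I where "I \<in> imag_units" "q = emb I (sphere_coord q)"
proof (cases "(qim1 q)\<^sup>2 + (qim2 q)\<^sup>2 + (qim3 q)\<^sup>2 = 0")
  case True
  then have "qim1 q = 0" "qim2 q = 0" "qim3 q = 0"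
    by (smt (verit) zero_le_power2 power2_eq_iff power_zero_numeral zero_less_power2)+
  then have "q = emb quat_i (sphere_coord q)"
    by (simp add: quat_eq_iff emb_components sphere_coord_def)
  then show ?thesis
    using that quat_ij_units by blast
next
  case False
  define r where "r = sqrt ((qim1 q)\<^sup>2 + (qim2 q)\<^sup>2 + (qim3 q)\<^sup>2)"
  have r2: "r\<^sup>2 = (qim1 q)\<^sup>2 + (qim2 q)\<^sup>2 + (qim3 q)\<^sup>2" and r: "r \<noteq> 0"
    using False by (simp_all add: r_def)
  define I where "I = Quat 0 (qim1 q / r) (qim2 q / r) (qim3 q / r)"
  have "(qim1 q / r)\<^sup>2 + (qim2 q / r)\<^sup>2 + (qim3 q / r)\<^sup>2 = r\<^sup>2 / r\<^sup>2"
    unfolding power_divide by (subst (4) r2) (simp add: add_divide_distrib)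
  then have I: "I \<in> imag_units"
    using r by (simp add: imag_units_iff I_def)
  moreover have "q = emb I (sphere_coord q)"
    using r I by (simp add: quat_eq_iff emb_components) (simp add: sphere_coord_def I_def flip: r_def)
  ultimately show ?thesis
    using that by blast
qed

lemma continuous_sphere_coord: "continuous_on S sphere_coord"
proof -
  have "continuous_on S (\<lambda>q. inner u q)" for u :: quat
    by (intro continuous_intros)
  from this [of "Quat 1 0 0 0"] this [of "Quat 0 1 0 0"] this [of "Quat 0 0 1 0"]
    this [of "Quat 0 0 0 1"]
  have c: "continuous_on S qre" "continuous_on S qim1" "continuous_on S qim2" "continuous_on S qim3"
    by (simp_all add: inner_quat_def)
  have eq: "sphere_coord = (\<lambda>q. of_real (qre q)
      + \<i> * of_real (sqrt ((qim1 q)\<^sup>2 + (qim2 q)\<^sup>2 + (qim3 q)\<^sup>2)))"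
    by (auto simp: fun_eq_iff complex_eq_iff sphere_coord_def)
  show ?thesis
    unfolding eq by (intro continuous_intros c)
qed

lemma mem_sphere_at_iff: "q \<in> sphere_at x y \<longleftrightarrow> (\<exists>J\<in>imag_units. q = emb J (Complex x y))"
  by (auto simp: sphere_at_def spt_eq_emb)

lemma emb_mem_sphere_at_iff:
  assumes "I \<in> imag_units"
  shows "emb I z \<in> sphere_at (Re w) (Im w) \<longleftrightarrow> z = w \<or> z = cnj w"
proof
  assume "emb I z \<in> sphere_at (Re w) (Im w)"
  then obtain J where J: "J \<in> imag_units" "emb I z = emb J w"
    by (auto simp: mem_sphere_at_iff)
  then have "Complex (Re z) \<bar>Im z\<bar> = Complex (Re w) \<bar>Im w\<bar>"
    using sphere_coord_emb [OF assms, of z] sphere_coord_emb [of J w] by simp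
  then show "z = w \<or> z = cnj w"
    by (auto simp: complex_eq_iff abs_if split: if_splits)
next
  assume "z = w \<or> z = cnj w"
  then have "emb I z = emb I w \<or> emb I z = emb (- I) w"
    by (auto simp: emb_uminus_unit)
  then show "emb I z \<in> sphere_at (Re w) (Im w)"
    using assms uminus_imag_unit [OF assms] by (auto simp: mem_sphere_at_iff)
qed

section \<open>Symmetric slice domains and plane domains\<close>

text \<open>
  For symmetric slice domains the slice of any other unit gives the same plane set.
\<close>
definition slice_trace :: "quat set \<Rightarrow> complex set" where
  "slice_trace D = {z. emb quat_i z \<in> D}"

lemma emb_mem_iff_slice_trace:
  assumes "symmetric_slice_domain D" "I \<in> imag_units"
  shows "emb I z \<in> D \<longleftrightarrow> z \<in> slice_trace D"
proof -
  have "emb J z \<in> D" if "emb K z \<in> D" "J \<in> imag_units" "K \<in> imag_units" for J K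
  proof -
    have "sphere_at (Re z) (Im z) \<subseteq> D"
      using assms that by (auto simp: symmetric_slice_domain_def emb_def)
    moreover have "emb J z \<in> sphere_at (Re z) (Im z)"
      using that by (auto simp: mem_sphere_at_iff)
    ultimately show ?thesis by blast
  qed
  then show ?thesis
    using assms by (auto simp: slice_trace_def)
qed

lemma cnj_mem_slice_trace:
  assumes "symmetric_slice_domain D" "z \<in> slice_trace D"
  shows "cnj z \<in> slice_trace D"
  using emb_mem_iff_slice_trace [OF assms(1), of "- quat_i"] assms(2) uminus_imag_unit
  by (simp add: emb_uminus_unit slice_trace_def)

lemma open_of_ssd: "symmetric_slice_domain D \<Longrightarrow> open D"
  by (simp add: symmetric_slice_domain_def domain_in_def)

lemma open_slice_trace:
  assumes "symmetric_slice_domain D"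
  shows "open (slice_trace D)"
proof -
  have "slice_trace D = emb quat_i -` D"
    by (auto simp: slice_trace_def)
  then show ?thesis
    using open_of_ssd [OF assms] continuous_emb [OF quat_ij_units(1), of UNIV]
    by (simp add: open_vimage)
qed

lemma connected_slice_trace:
  assumes "symmetric_slice_domain D"
  shows "connected (slice_trace D)"
proof -
  have "slice_trace D = slice_coord quat_i ` (D \<inter> slice quat_i)"
    by (auto simp: slice_trace_def image_iff emb_slice_coord)
      (metis IntI emb_in_slice quat_ij_units(1) slice_coord_emb)
  moreover have "connected (D \<inter> slice quat_i)"
    using assms by (simp add: symmetric_slice_domain_def domain_in_def)
  ultimately show ?thesis
    by (simp add: connected_continuous_image bounded_linear_slice_coord linear_continuous_on)
qed

lemma real_point_slice_trace:
  assumes "symmetric_slice_domain D"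
  obtains x where "complex_of_real x \<in> slice_trace D"
proof -
  obtain x :: real where "of_real x \<in> D"
    using assms by (auto simp: symmetric_slice_domain_def)
  then have "complex_of_real x \<in> slice_trace D"
    by (simp add: slice_trace_def)
  then show ?thesis
    by (rule that)
qed

definition circularization :: "complex set \<Rightarrow> quat set" where
  "circularization S = {q. sphere_coord q \<in> S}"

lemma emb_mem_circularization_iff:
  assumes "\<And>z. z \<in> S \<Longrightarrow> cnj z \<in> S" "I \<in> imag_units"
  shows "emb I z \<in> circularization S \<longleftrightarrow> z \<in> S"
  using sphere_coord_emb_cases [OF assms(2), of z] assms(1) [of z] assms(1) [of "cnj z"]
  unfolding circularization_def by (metis complex_cnj_cnj mem_Collect_eq)

lemma slice_trace_circularization:
  assumes "\<And>z. z \<in> S \<Longrightarrow> cnj z \<in> S"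
  shows "slice_trace (circularization S) = S"
  unfolding slice_trace_def using emb_mem_circularization_iff [OF assms quat_ij_units(1)] by blast

lemma circularization_slice_trace:
  assumes "symmetric_slice_domain D"
  shows "circularization (slice_trace D) = D"
proof -
  have "sphere_coord q \<in> slice_trace D \<longleftrightarrow> q \<in> D" for q
    using ex_unit_sphere_coord [of q] emb_mem_iff_slice_trace [OF assms] by metis
  then show ?thesis
    by (auto simp: circularization_def)
qed

text \<open>
  The rotated set is connected because it is the union of copies of \<open>S\<close>, one for each slice, which
  all pass through the same real point.
\<close>
lemma symmetric_slice_domain_circularization:
  assumes "open S" "connected S" "\<And>z. z \<in> S \<Longrightarrow> cnj z \<in> S" "complex_of_real x \<in> S"
  shows "symmetric_slice_domain (circularization S)"
proof -
  have iff: "emb I z \<in> circularization S \<longleftrightarrow> z \<in> S" if "I \<in> imag_units" for I z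
    using emb_mem_circularization_iff assms(3) that by blast
  have "circularization S = sphere_coord -` S"
    by (auto simp: circularization_def)
  then have op: "open (circularization S)"
    using assms(1) continuous_sphere_coord [of UNIV] by (simp add: open_vimage)
  have slices: "circularization S \<inter> slice I = emb I ` S" if "I \<in> imag_units" for I
    using iff that by (auto simp: mem_slice_iff)
  have conn: "connected (emb I ` S)" if "I \<in> imag_units" for I
    using assms(2) continuous_emb [OF that] by (rule connected_continuous_image [rotated])
  have "circularization S = (\<Union>I\<in>imag_units. emb I ` S)"
    using iff by (auto simp: image_iff) (metis ex_unit_sphere_coord)
  moreover have "connected (\<Union>I\<in>imag_units. emb I ` S)"
  proof (rule connected_Union)
    have "of_real x \<in> emb I ` S" for I
      using assms(4) by (metis emb_simps(3) imageI)
    then have "of_real x \<in> \<Inter> ((\<lambda>I. emb I ` S) ` imag_units)"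
      by blast
    then show "\<Inter> ((\<lambda>I. emb I ` S) ` imag_units) \<noteq> {}"
      by blast
  qed (use conn in auto)
  ultimately have con: "connected (circularization S)"
    by simp
  have real: "of_real x \<in> circularization S"
    using iff [OF quat_ij_units(1), of "of_real x"] assms(4) by simp
  have op_slice: "openin (top_of_set (slice I)) (emb I ` S)" if "I \<in> imag_units" for I
    using op slices [OF that] by (metis inf_commute openin_open)
  have "sphere_at a b \<subseteq> circularization S" if "spt I a b \<in> circularization S" "I \<in> imag_units" for I a b
    using that iff by (auto simp: mem_sphere_at_iff spt_eq_emb)
  then show ?thesis
    unfolding symmetric_slice_domain_def domain_in_def
    using op op_slice slices conn assms(4) con real by auto
qed

section \<open>Stem functions of slice preserving regular functions\<close>

text \<open>
  The quaternions \<open>a\<close> and \<open>b\<close> are the partial derivatives. Their continuity makes the function totally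
  differentiable on the slice, and the last equation is the Cauchy-Riemann equation.
\<close>
lemma regular_has_derivative:
  assumes "open U" "regular_on U f" "I \<in> imag_units" "emb I z \<in> U"
  obtains a b where "((\<lambda>w. f (emb I w)) has_derivative (\<lambda>h. Re h *\<^sub>R a + Im h *\<^sub>R b)) (at z)"
    and "a + I * b = 0"
proof -
  define S where "S = {(x, y). spt I x y \<in> U}"
  obtain fx fy where cont: "continuous_on S (\<lambda>(x, y). fy x y)"
    and d: "\<And>x y. spt I x y \<in> U \<Longrightarrow>
           ((\<lambda>t. f (spt I t y)) has_vector_derivative fx x y) (at x) \<and>
           ((\<lambda>t. f (spt I x t)) has_vector_derivative fy x y) (at y) \<and>
           (1/2) *\<^sub>R (fx x y + I * fy x y) = 0"
    using assms(2,3) unfolding regular_on_def S_def by metis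
  have "S = (\<lambda>p. spt I (fst p) (snd p)) -` U"
    by (auto simp: S_def)
  moreover have "continuous_on UNIV (\<lambda>p. spt I (fst p) (snd p))"
    unfolding spt_def by (intro continuous_intros)
  ultimately have "open S"
    using assms(1) by (simp add: open_vimage)
  define x where "x = Re z"
  define y where "y = Im z"
  have xyS: "(x, y) \<in> S" and xyU: "spt I x y \<in> U"
    using assms(4) by (auto simp: S_def x_def y_def emb_def)
  obtain X0 Y0 where "open X0" "open Y0" "(x, y) \<in> X0 \<times> Y0" "X0 \<times> Y0 \<subseteq> S"
    using \<open>open S\<close> xyS by (rule open_prod_elim)
  then obtain e e' where e: "e > 0" "ball x e \<subseteq> X0" "e' > 0" "ball y e' \<subseteq> Y0"
    by (metis SigmaE2 open_contains_ball)
  define X where "X = ball x e"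
  define Y where "Y = ball y e'"
  have XY: "X \<times> Y \<subseteq> S"
    using \<open>X0 \<times> Y0 \<subseteq> S\<close> e unfolding X_def Y_def by blast
  have xy: "x \<in> X" "y \<in> Y" "open X" "open Y" "convex Y"
    using e by (auto simp: X_def Y_def)
  have "((\<lambda>(x, y). f (spt I x y)) has_derivative
      (\<lambda>(tx, ty). tx *\<^sub>R fx x y + blinfun_scaleR_left (fy x y) ty)) (at (x, y) within X \<times> Y)"
  proof (rule has_derivative_partialsI)
    show "((\<lambda>x. f (spt I x y)) has_derivative (\<lambda>tx. tx *\<^sub>R fx x y)) (at x within X)"
      using d [OF xyU] unfolding has_vector_derivative_def
      by (auto intro: has_derivative_at_withinI)
    show "((\<lambda>y. f (spt I x y)) has_derivative blinfun_apply (blinfun_scaleR_left (fy x y))) (at y within Y)"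
      if "x \<in> X" "y \<in> Y" for x y
    proof -
      have "spt I x y \<in> U"
        using that XY by (auto simp: S_def)
      then show ?thesis
        using d unfolding has_vector_derivative_def
        by (auto intro: has_derivative_at_withinI)
    qed
    have "isCont (\<lambda>(x, y). fy x y) (x, y)"
      using cont \<open>open S\<close> xyS by (simp add: continuous_on_eq_continuous_at)
    then have "isCont (\<lambda>p. blinfun_scaleR_left ((\<lambda>(x, y). fy x y) p)) (x, y)"
      by (intro bounded_linear.continuous [OF bounded_linear_blinfun_scaleR_left])
    then show "continuous (at (x, y) within X \<times> Y) (\<lambda>(x, y). blinfun_scaleR_left (fy x y))"
      by (simp add: case_prod_unfold continuous_at_imp_continuous_at_within)
  qed (use xy in auto)
  then have "((\<lambda>(x, y). f (spt I x y)) has_derivative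
      (\<lambda>(tx, ty). tx *\<^sub>R fx x y + ty *\<^sub>R fy x y)) (at (Re z, Im z))"
    using xy at_within_open [of "(x, y)" "X \<times> Y"] by (simp add: open_Times x_def y_def)
  moreover have "((\<lambda>w. (Re w, Im w)) has_derivative (\<lambda>h. (Re h, Im h))) (at z)"
    by (intro derivative_intros has_derivative_Re has_derivative_Im)
  ultimately have "((\<lambda>w. f (emb I w)) has_derivative
      (\<lambda>h. Re h *\<^sub>R fx x y + Im h *\<^sub>R fy x y)) (at z)"
    using has_derivative_compose [of "\<lambda>w. (Re w, Im w)" "\<lambda>h. (Re h, Im h)" z UNIV
        "\<lambda>(x, y). f (spt I x y)" "\<lambda>(tx, ty). tx *\<^sub>R fx x y + ty *\<^sub>R fy x y"]
    by (simp add: emb_def)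
  moreover have "fx x y + I * fy x y = 0"
    using d [OF xyU] by simp
  ultimately show ?thesis
    by (rule that)
qed

text \<open>
  Since \<open>I = emb I \<i>\<close>, projecting the Cauchy-Riemann equation \<open>a + I * b = 0\<close> to the slice gives
  \<open>b = \<i> * a\<close> for the projections, that is, a complex linear derivative. The values of \<open>f\<close> may lie
  outside the slice, which is what the treatment of regular extensions across a singularity needs.
\<close>
lemma regular_imp_holomorphic:
  assumes "open U" "regular_on U f" "I \<in> imag_units"
  shows "(\<lambda>z. slice_coord I (f (emb I z))) holomorphic_on {z. emb I z \<in> U}"
proof -
  have "\<exists>D. ((\<lambda>z. slice_coord I (f (emb I z))) has_field_derivative D) (at z)"
    if z: "emb I z \<in> U" for z
  proof -
    obtain a b where ab: "((\<lambda>w. f (emb I w)) has_derivative (\<lambda>h. Re h *\<^sub>R a + Im h *\<^sub>R b)) (at z)"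
      and cr: "a + I * b = 0"
      using regular_has_derivative assms z by blast
    interpret sc: bounded_linear "slice_coord I"
      by (rule bounded_linear_slice_coord)
    have "emb I \<i> = I"
      by (simp add: emb_def spt_def)
    then have "slice_coord I a + \<i> * slice_coord I b = 0"
      using arg_cong [OF cr, of "slice_coord I"] slice_coord_emb_mult [OF assms(3), of \<i> b]
      by (simp add: sc.add sc.zero)
    then have b: "slice_coord I b = \<i> * slice_coord I a"
      by (simp add: complex_eq_iff)
    have "((\<lambda>z. slice_coord I (f (emb I z))) has_derivative
        (\<lambda>h. slice_coord I (Re h *\<^sub>R a + Im h *\<^sub>R b))) (at z)"
      by (rule sc.has_derivative [OF ab])
    moreover have "slice_coord I (Re h *\<^sub>R a + Im h *\<^sub>R b) = slice_coord I a * h" for h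
      by (simp add: sc.add sc.scaleR b complex_eq_iff algebra_simps)
    ultimately show ?thesis
      unfolding has_field_derivative_def by (auto simp: fun_eq_iff)
  qed
  then show ?thesis
    unfolding holomorphic_on_def field_differentiable_def
    by (blast intro: has_field_derivative_at_within)
qed

text \<open>
  One and the same complex function describes \<open>f\<close> on every slice.
\<close>
definition stem :: "quat set \<Rightarrow> (quat \<Rightarrow> quat) \<Rightarrow> (complex \<Rightarrow> complex) \<Rightarrow> bool" where
  "stem A f F \<longleftrightarrow> (\<forall>I\<in>imag_units. \<forall>z\<in>slice_trace A. f (emb I z) = emb I (F z))"

lemma stemD: "stem A f F \<Longrightarrow> I \<in> imag_units \<Longrightarrow> z \<in> slice_trace A \<Longrightarrow> f (emb I z) = emb I (F z)"
  by (simp add: stem_def)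

text \<open>
  The units \<open>I\<close> and \<open>- I\<close> span the same slice, with conjugate complex coordinates.
\<close>
lemma stem_cnj:
  assumes "symmetric_slice_domain A" "stem A f F" "z \<in> slice_trace A"
  shows "F (cnj z) = cnj (F z)"
proof -
  have "emb quat_i (F (cnj z)) = f (emb quat_i (cnj z))"
    using stemD [OF assms(2) quat_ij_units(1) cnj_mem_slice_trace [OF assms(1,3)]] by simp
  also have "\<dots> = f (emb (- quat_i) z)"
    by (simp add: emb_uminus_unit)
  also have "\<dots> = emb (- quat_i) (F z)"
    using assms uminus_imag_unit [of quat_i] by (simp add: stemD)
  finally show ?thesis
    by (simp add: emb_uminus_unit emb_eq_iff)
qed

lemma islimpt_reals:
  assumes "open S" "complex_of_real x \<in> S"
  shows "complex_of_real x islimpt (S \<inter> \<real>)"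
proof -
  have "\<exists>x'\<in>S \<inter> \<real>. x' \<noteq> complex_of_real x \<and> dist x' (complex_of_real x) < e" if "e > 0" for e
  proof -
    obtain d where d: "d > 0" "ball (complex_of_real x) d \<subseteq> S"
      using assms by (meson open_contains_ball)
    define t where "t = complex_of_real (x + min d e / 2)"
    have "dist t (of_real x) = min d e / 2"
      using d that by (simp add: t_def dist_norm)
    then have "dist t (of_real x) < d" "dist t (of_real x) < e" "t \<noteq> of_real x" "t \<in> \<real>"
      using d that by (auto simp: t_def)
    then show ?thesis
      using d by (intro bexI [of _ t]) (auto simp: dist_commute)
  qed
  then show ?thesis
    unfolding islimpt_approachable by blast
qed

text \<open>
  On the slice of \<open>I\<close> the function \<open>f\<close> is given by a holomorphic \<open>F I\<close>. All these functions agree on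
  the real points of the domain, and there are enough of them for the identity theorem.
\<close>
lemma slice_preserving_imp_stem:
  assumes A: "symmetric_slice_domain A" and f: "slice_preserving_on A f"
  obtains F where "stem A f F" "F holomorphic_on slice_trace A"
proof -
  define F where "F = (\<lambda>I z. slice_coord I (f (emb I z)))"
  have hol: "F I holomorphic_on slice_trace A" if "I \<in> imag_units" for I
  proof -
    have "{z. emb I z \<in> A} = slice_trace A"
      using emb_mem_iff_slice_trace [OF A that] by auto
    then show ?thesis
      using regular_imp_holomorphic [OF open_of_ssd [OF A] _ that, of f] f
      by (simp add: F_def slice_preserving_on_def)
  qed
  have mem: "f (emb I z) \<in> slice I" if "I \<in> imag_units" "z \<in> slice_trace A" for I z
    using f that emb_mem_iff_slice_trace [OF A] by (force simp: slice_preserving_on_def)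
  have val: "f (emb I z) = emb I (F I z)" if "I \<in> imag_units" "z \<in> slice_trace A" for I z
    using mem [OF that] that by (simp add: F_def emb_slice_coord)
  \<comment> \<open>On the real axis all slices meet, so the value is real and all \<open>F I\<close> agree.\<close>
  have real: "F I z = F quat_i z" if "z \<in> slice_trace A \<inter> \<real>" "I \<in> imag_units" for I z
  proof -
    have "z \<in> \<real>"
      using that(1) by blast
    then obtain t where t: "z = of_real t"
      by (rule Reals_cases)
    define q where "q = f (of_real t)"
    have "q = of_real (qre q)"
      using mem [of quat_i z] mem [of quat_j z] that by (intro slice_i_Int_slice_j) (auto simp: t q_def)
    moreover have "slice_coord J (of_real r) = of_real r" if "J \<in> imag_units" for J r
      using slice_coord_emb [OF that, of "of_real r"] by simp
    ultimately show ?thesis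
      using that(2) by (metis F_def emb_simps(3) q_def quat_ij_units(1) t)
  qed
  obtain x where x: "complex_of_real x \<in> slice_trace A"
    using real_point_slice_trace [OF A] .
  have "F I z = F quat_i z" if I: "I \<in> imag_units" and z: "z \<in> slice_trace A" for I z
  proof -
    have "F I z - F quat_i z = 0"
    proof (rule analytic_continuation [where f = "\<lambda>w. F I w - F quat_i w"])
      show "(\<lambda>w. F I w - F quat_i w) holomorphic_on slice_trace A"
        using hol I by (intro holomorphic_intros) auto
      show "complex_of_real x islimpt (slice_trace A \<inter> \<real>)"
        using islimpt_reals open_slice_trace A x by blast
      show "F I w - F quat_i w = 0" if "w \<in> slice_trace A \<inter> \<real>" for w
        using real [OF that I] by simp
    qed (fact open_slice_trace [OF A] connected_slice_trace [OF A] x z Int_lower1)+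
    then show ?thesis by simp
  qed
  then have "stem A f (F quat_i)"
    unfolding stem_def using val by metis
  then show ?thesis
    by (rule that) (rule hol [OF quat_ij_units(1)])
qed

text \<open>
  The partial derivatives on the slice of \<open>I\<close> are \<open>emb I (F' z)\<close> and \<open>emb I (\<i> * F' z)\<close>.
\<close>
lemma stem_imp_slice_preserving:
  assumes A: "symmetric_slice_domain A" and st: "stem A f F" and hol: "F holomorphic_on slice_trace A"
  shows "slice_preserving_on A f"
proof -
  note iff = emb_mem_iff_slice_trace [OF A]
  have op: "open (slice_trace A)"
    by (rule open_slice_trace [OF A])
  have F': "(F has_field_derivative deriv F z) (at z)" if "z \<in> slice_trace A" for z
    using hol op that by (rule holomorphic_derivI)
  have "\<exists>fx fy.
        continuous_on {(x, y). spt I x y \<in> A} (\<lambda>(x, y). fx x y) \<and>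
        continuous_on {(x, y). spt I x y \<in> A} (\<lambda>(x, y). fy x y) \<and>
        (\<forall>x y. spt I x y \<in> A \<longrightarrow>
           ((\<lambda>t. f (spt I t y)) has_vector_derivative fx x y) (at x) \<and>
           ((\<lambda>t. f (spt I x t)) has_vector_derivative fy x y) (at y) \<and>
           (1/2) *\<^sub>R (fx x y + I * fy x y) = 0)" if I: "I \<in> imag_units" for I
  proof -
    interpret e: bounded_linear "emb I"
      by (rule bounded_linear_emb [OF I])
    have memA: "spt I x y \<in> A \<longleftrightarrow> Complex x y \<in> slice_trace A" for x y
      using iff I by (simp add: spt_eq_emb)
    have val: "f (spt I x y) = emb I (F (Complex x y))" if "Complex x y \<in> slice_trace A" for x y
      using stemD [OF st I that] by (simp add: spt_eq_emb)
    have "continuous_on (slice_trace A) (deriv F)"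
      using hol op by (intro holomorphic_on_imp_continuous_on holomorphic_deriv)
    moreover have "continuous_on T (\<lambda>p. Complex (fst p) (snd p))" for T
      by (simp add: Complex_eq) (intro continuous_intros)
    ultimately have c: "continuous_on {p. spt I (fst p) (snd p) \<in> A} (\<lambda>p. deriv F (Complex (fst p) (snd p)))"
      by (rule continuous_on_compose2) (auto simp: memA)
    have c1: "continuous_on {(x, y). spt I x y \<in> A} (\<lambda>(x, y). emb I (deriv F (Complex x y)))"
      using e.continuous_on [OF c] by (simp add: case_prod_unfold)
    have c2: "continuous_on {(x, y). spt I x y \<in> A} (\<lambda>(x, y). emb I (\<i> * deriv F (Complex x y)))"
      using e.continuous_on [OF continuous_on_mult [OF continuous_on_const c]]
      by (simp add: case_prod_unfold)
    have d1: "((\<lambda>t. f (spt I t y)) has_vector_derivative emb I (deriv F (Complex x y))) (at x)"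
      and d2: "((\<lambda>t. f (spt I x t)) has_vector_derivative emb I (\<i> * deriv F (Complex x y))) (at y)"
      if z: "Complex x y \<in> slice_trace A" for x y
    proof -
      have "((\<lambda>t. Complex t y) has_vector_derivative 1) (at x)"
        unfolding Complex_eq by (auto intro!: derivative_eq_intros)
      then have "((F \<circ> (\<lambda>t. Complex t y)) has_vector_derivative (1 * deriv F (Complex x y))) (at x)"
        using F' [OF z] by (intro field_vector_diff_chain_at)
      then have v: "((\<lambda>t. emb I (F (Complex t y))) has_vector_derivative emb I (deriv F (Complex x y))) (at x)"
        using e.has_vector_derivative by (fastforce simp: o_def)
      have "(\<lambda>t. Complex t y) -` slice_trace A = {t. Complex t y \<in> slice_trace A}"
        by auto
      moreover have "continuous_on UNIV (\<lambda>t. Complex t y)"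
        unfolding Complex_eq by (intro continuous_intros)
      ultimately have o: "open {t. Complex t y \<in> slice_trace A}"
        using op open_vimage by metis
      show "((\<lambda>t. f (spt I t y)) has_vector_derivative emb I (deriv F (Complex x y))) (at x)"
        by (rule has_vector_derivative_transform_within_open [OF v o]) (use z val in auto)
      have "((\<lambda>t. Complex x t) has_vector_derivative \<i>) (at y)"
        unfolding Complex_eq by (auto intro!: derivative_eq_intros)
      then have "((F \<circ> (\<lambda>t. Complex x t)) has_vector_derivative (\<i> * deriv F (Complex x y))) (at y)"
        using F' [OF z] by (intro field_vector_diff_chain_at)
      then have v: "((\<lambda>t. emb I (F (Complex x t))) has_vector_derivative emb I (\<i> * deriv F (Complex x y))) (at y)"
        using e.has_vector_derivative by (fastforce simp: o_def)
      have "(\<lambda>t. Complex x t) -` slice_trace A = {t. Complex x t \<in> slice_trace A}"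
        by auto
      moreover have "continuous_on UNIV (\<lambda>t. Complex x t)"
        unfolding Complex_eq by (intro continuous_intros)
      ultimately have o: "open {t. Complex x t \<in> slice_trace A}"
        using op open_vimage by metis
      show "((\<lambda>t. f (spt I x t)) has_vector_derivative emb I (\<i> * deriv F (Complex x y))) (at y)"
        by (rule has_vector_derivative_transform_within_open [OF v o]) (use z val in auto)
    qed
    have cr: "(1/2) *\<^sub>R (emb I w + I * emb I (\<i> * w)) = 0" for w
    proof -
      have "I = emb I \<i>"
        by (simp add: emb_def spt_def)
      then have "I * emb I (\<i> * w) = emb I (\<i> * (\<i> * w))"
        using emb_mult [OF I, of \<i> "\<i> * w"] by simp
      also have "\<i> * (\<i> * w) = - w"
        by simp
      finally show ?thesis by simp
    qed
    show ?thesis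
      using c1 c2 d1 d2 cr
      by (intro exI [of _ "\<lambda>x y. emb I (deriv F (Complex x y))"]
          exI [of _ "\<lambda>x y. emb I (\<i> * deriv F (Complex x y))"]) (simp add: memA)
  qed
  then have "regular_on A f"
    by (simp add: regular_on_def)
  moreover have "f ` (A \<inter> slice I) \<subseteq> slice I" if "I \<in> imag_units" for I
    using stemD [OF st that] iff [OF that] emb_in_slice by (fastforce simp: mem_slice_iff)
  ultimately show ?thesis
    by (simp add: slice_preserving_on_def)
qed

section \<open>Singularities and meromorphic stem functions\<close>

text \<open>
  The Laurent series is a shifted power series, which converges absolutely inside its disc of
  convergence; unordered summation over all integers is the form in which poles of quaternionic
  functions are defined.
\<close>
lemma meromorphic_imp_laurent_has_sum:
  assumes "F meromorphic_on {z}"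
  obtains R N c where "R > 0" "\<forall>n<N. c n = 0"
    "\<forall>w. w \<noteq> z \<and> dist w z < R \<longrightarrow> ((\<lambda>n::int. (w - z) powi n * c n) has_sum F w) UNIV"
proof -
  obtain L where L: "(\<lambda>w. F (z + w)) has_laurent_expansion L"
    using assms by (auto simp: meromorphic_on_def)
  define P where "P = fls_base_factor_to_fps L"
  define N where "N = fls_subdegree L"
  have "0 < fls_conv_radius L" and ev: "eventually (\<lambda>h. eval_fls L h = F (z + h)) (at 0)"
    using L by (auto simp: has_laurent_expansion_def)
  then have pos: "0 < fps_conv_radius P"
    by (simp add: fls_conv_radius_altdef P_def)
  obtain r where r: "r > 0" "\<And>h. h \<noteq> 0 \<Longrightarrow> dist h 0 < r \<Longrightarrow> eval_fls L h = F (z + h)"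
    using ev unfolding eventually_at by auto
  obtain R :: real where R: "R > 0" "R \<le> min r (fps_conv_radius P)"
    using pos r(1) by (metis dual_order.strict_implies_order ereal_dense2 ereal_less(2) min_def)
  define c where "c = (\<lambda>n. if n < N then 0 else fps_nth P (nat (n - N)))"
  have "((\<lambda>n::int. (w - z) powi n * c n) has_sum F w) UNIV" if w: "w \<noteq> z" "dist w z < R" for w
  proof -
    define h where "h = w - z"
    have h: "h \<noteq> 0" "norm h < R" "dist h 0 < r"
      using w R by (auto simp: h_def dist_norm)
    have "ereal (norm h) < fps_conv_radius P"
      using h(2) R(2) by (metis less_ereal.simps(1) min.bounded_iff order_less_le_trans)
    then have "((\<lambda>n. fps_nth P n * h ^ n) has_sum eval_fps P h) UNIV"
      by (intro norm_summable_imp_has_sum norm_summable_fps sums_eval_fps)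
    then have "((\<lambda>n. h powi N * (fps_nth P n * h ^ n)) has_sum (h powi N * eval_fps P h)) UNIV"
      by (rule has_sum_cmult_right)
    also have "h powi N * eval_fps P h = F w"
      using r(2) [OF h(1) h(3)] by (simp add: eval_fls_def P_def N_def h_def mult.commute)
    also have "((\<lambda>n. h powi N * (fps_nth P n * h ^ n)) has_sum F w) UNIV
        \<longleftrightarrow> ((\<lambda>n. h powi n * c n) has_sum F w) {N..}"
    proof (rule has_sum_reindex_bij_witness [where j = "\<lambda>k. N + int k" and i = "\<lambda>n. nat (n - N)"])
      show "h powi (N + int k) * c (N + int k) = h powi N * (fps_nth P k * h ^ k)" for k
        using h(1) by (simp add: c_def power_int_add)
    qed auto
    also have "\<dots> \<longleftrightarrow> ((\<lambda>n. h powi n * c n) has_sum F w) UNIV"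
      by (rule has_sum_cong_neutral) (auto simp: c_def)
    finally show ?thesis
      by (simp add: h_def)
  qed
  then show ?thesis
    using that [of R N c] R(1) by (simp add: c_def)
qed

text \<open>
  Multiplying by a power of \<open>w - z\<close> clears the principal part. The product is given by a power
  series, so it has a limit at \<open>z\<close> and is meromorphic there; dividing by the power preserves this.
\<close>
lemma laurent_has_sum_imp_meromorphic:
  assumes "R > 0" and c: "\<And>n. n < N \<Longrightarrow> c n = 0"
    and sum: "\<And>w. \<lbrakk>w \<noteq> z; dist w z < R\<rbrakk> \<Longrightarrow> ((\<lambda>n::int. (w - z) powi n * c n) has_sum F w) UNIV"
    and iso: "isolated_singularity_at F z"
  shows "F meromorphic_on {z}"
proof -
  define G where "G = (\<lambda>w. F w * (w - z) powi (- N))"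
  have G: "(\<lambda>k. c (N + int k) * h ^ k) sums G (z + h)" if h: "h \<noteq> 0" "norm h < R" for h
  proof -
    have "((\<lambda>n. h powi n * c n) has_sum F (z + h)) UNIV"
      using sum [of "z + h"] h by (simp add: dist_norm)
    then have "((\<lambda>n. h powi (- N) * (h powi n * c n)) has_sum (h powi (- N) * F (z + h))) UNIV"
      by (rule has_sum_cmult_right)
    also have "h powi (- N) * F (z + h) = G (z + h)"
      by (simp add: G_def)
    also have "((\<lambda>n. h powi (- N) * (h powi n * c n)) has_sum G (z + h)) UNIV
        \<longleftrightarrow> ((\<lambda>n. h powi (- N) * (h powi n * c n)) has_sum G (z + h)) {N..}"
      by (rule has_sum_cong_neutral) (auto simp: c)
    also have "\<dots> \<longleftrightarrow> ((\<lambda>k. c (N + int k) * h ^ k) has_sum G (z + h)) UNIV"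
    proof (rule has_sum_reindex_bij_witness [symmetric,
          where j = "\<lambda>k. N + int k" and i = "\<lambda>n. nat (n - N)"])
      show "h powi (- N) * (h powi (N + int k) * c (N + int k)) = c (N + int k) * h ^ k" for k
        using h(1) by (simp add: power_int_add power_int_minus)
    qed auto
    finally show ?thesis
      by (rule has_sum_imp_sums)
  qed
  \<comment> \<open>The constant term is written as the value at index zero to match the power series.\<close>
  have "((\<lambda>h. G (z + h)) \<longlongrightarrow> c (N + int 0)) (at 0)"
    using powser_limit_0_strong [OF \<open>R > 0\<close>, of "\<lambda>k. c (N + int k)" "\<lambda>h. G (z + h)"] G by blast
  then have "(G \<longlongrightarrow> c N) (at z)"
    by (simp add: LIM_offset_zero_iff)
  then have "not_essential G z"
    by (auto simp: not_essential_def)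
  moreover have "isolated_singularity_at G z"
  proof -
    have "(\<lambda>w. (w - z) powi (- N)) meromorphic_on {z}"
      by (intro meromorphic_intros)
    then show ?thesis
      unfolding G_def by (intro isolated_singularity_at_times iso meromorphic_on_isolated_singularity)
  qed
  ultimately have "G meromorphic_on {z}"
    by (simp add: meromorphic_at_iff)
  then have "(\<lambda>w. G w * (w - z) powi N) meromorphic_on {z}"
    by (intro meromorphic_intros)
  also have "?this \<longleftrightarrow> F meromorphic_on {z}"
  proof (rule meromorphic_on_cong)
    fix w assume "w \<in> {z}"
    have "eventually (\<lambda>w. w \<noteq> z) (at z)"
      by (simp add: eventually_at_filter)
    then have "\<forall>\<^sub>F w in at z. G w * (w - z) powi N = F w"
      by eventually_elim (simp add: G_def power_int_minus)
    with \<open>w \<in> {z}\<close> show "\<forall>\<^sub>F u in at w. G u * (u - z) powi N = F u"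
      by simp
  qed simp
  finally show ?thesis .
qed

text \<open>
  The complex counterpart of a pair in \<open>semireg_pairs D\<close>. The last condition says that the part of
  \<open>slice_trace D\<close> missing from \<open>slice_trace A\<close> has no accumulation point in \<open>slice_trace D\<close>.
\<close>
definition meromorphic_stem ::
    "quat set \<Rightarrow> quat set \<Rightarrow> (quat \<Rightarrow> quat) \<Rightarrow> (complex \<Rightarrow> complex) \<Rightarrow> bool" where
  "meromorphic_stem D A f F \<longleftrightarrow>
     symmetric_slice_domain A \<and> A \<subseteq> D \<and> stem A f F \<and> F holomorphic_on slice_trace A \<and>
     F meromorphic_on slice_trace D \<and> (\<forall>z\<in>slice_trace D. \<forall>\<^sub>F w in at z. w \<in> slice_trace A)"

lemma mem_punctured_disc_iff:
  assumes "I \<in> imag_units"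
  shows "emb I w \<in> punctured_disc I (emb I z) R \<longleftrightarrow> w \<noteq> z \<and> dist w z < R"
  using norm_emb [OF assms, of "w - z"] by (simp add: punctured_disc_def dist_norm emb_eq_iff [OF assms])

lemma slice_uminus: "slice (- I) = slice I"
proof -
  have "emb (- I) z \<in> slice I" "emb I z \<in> slice (- I)" for z
    using emb_in_slice [of I "cnj z"] emb_in_slice [of "- I" "cnj z"]
    by (simp_all add: emb_uminus_unit del: emb_in_slice)
  then show ?thesis
    by (auto simp: mem_slice_iff)
qed

text \<open>
  Lets the unit that comes with a singularity be replaced by its negative, so that the singular
  point has a prescribed one of its two conjugate complex coordinates.
\<close>
lemma sing_uminus:
  "pole_sing (- I) A f p \<longleftrightarrow> pole_sing I A f p" "removable_sing (- I) A f p \<longleftrightarrow> removable_sing I A f p"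
  by (simp_all add: pole_sing_def removable_sing_def singularity_in_def punctured_disc_def slice_uminus)

text \<open>
  The regular extension \<open>g\<close> may leave the slices, but its projection to the slice of \<open>I\<close> is
  holomorphic near \<open>z\<close> and agrees with the stem function wherever the latter describes \<open>f\<close>.
\<close>
lemma removable_imp_meromorphic:
  assumes A: "symmetric_slice_domain A" and st: "stem A f F" and I: "I \<in> imag_units"
    and ev: "\<forall>\<^sub>F w in at z. w \<in> slice_trace A"
    and U: "open U" "emb I z \<in> U" "regular_on U g" "\<And>q. q \<in> U \<inter> A \<Longrightarrow> g q = f q"
  obtains G where "G analytic_on {z}" "\<forall>\<^sub>F w in at z. G w = F w"
proof
  define G where "G = (\<lambda>w. slice_coord I (g (emb I w)))"
  have "{w. emb I w \<in> U} = emb I -` U"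
    by auto
  then have op: "open {w. emb I w \<in> U}"
    using open_vimage [OF U(1) continuous_emb [OF I]] by simp
  show "G analytic_on {z}"
    unfolding analytic_at G_def
    using op U(2) regular_imp_holomorphic [OF U(1,3) I] by blast
  have "\<forall>\<^sub>F w in at z. w \<in> {w. emb I w \<in> U}"
    using op U(2) by (intro eventually_at_in_open') auto
  with ev show "\<forall>\<^sub>F w in at z. G w = F w"
  proof eventually_elim
    case (elim w)
    then have "g (emb I w) = f (emb I w)"
      using U(4) emb_mem_iff_slice_trace [OF A I] by blast
    then show ?case
      using stemD [OF st I elim(1)] I by (simp add: G_def)
  qed
qed

text \<open>
  At a missing point the stem function has an isolated singularity. It is nonessential because
  either a regular extension or a Laurent expansion with finite principal part projects to the slice.
\<close>
lemma semireg_pairs_imp_meromorphic_stem: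
  assumes D: "symmetric_slice_domain D" and pair: "(A, f) \<in> semireg_pairs D"
  obtains F where "meromorphic_stem D A f F"
proof -
  have A: "symmetric_slice_domain A" "A \<subseteq> D" and sp: "slice_preserving_on A f"
    and sing: "\<And>p. p \<in> D - A \<Longrightarrow> \<exists>I\<in>imag_units. pole_sing I A f p \<or> removable_sing I A f p"
    using pair by (auto simp: semireg_pairs_def)
  obtain F where F: "stem A f F" and hol: "F holomorphic_on slice_trace A"
    using slice_preserving_imp_stem [OF A(1) sp] .
  have "F meromorphic_on {z} \<and> (\<forall>\<^sub>F w in at z. w \<in> slice_trace A)" if z: "z \<in> slice_trace D" for z
  proof (cases "z \<in> slice_trace A")
    case True
    have op: "open (slice_trace A)"
      by (rule open_slice_trace [OF A(1)])
    then have "F analytic_on {z}"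
      using hol True by (auto simp: analytic_at)
    then show ?thesis
      using op True by (auto intro: analytic_on_imp_meromorphic_on eventually_at_in_open')
  next
    case False
    define p where "p = emb quat_i z"
    \<comment> \<open>The singular point is described in the slice of some unit \<open>J\<close>, where its coordinate is \<open>z\<close> or
      its conjugate; in the second case the unit is negated.\<close>
    have "p \<in> D - A"
      using z False emb_mem_iff_slice_trace [of _ quat_i z] A D by (simp add: p_def)
    then obtain J where J: "J \<in> imag_units" "pole_sing J A f p \<or> removable_sing J A f p"
      using sing by blast
    then obtain w where "p = emb J w"
      by (auto simp: pole_sing_def removable_sing_def singularity_in_def mem_slice_iff)
    then have "emb J w \<in> sphere_at (Re z) (Im z)"
      using emb_mem_sphere_at_iff [OF quat_ij_units(1), of z z] by (simp add: p_def)
    then have "w = z \<or> w = cnj z"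
      using emb_mem_sphere_at_iff [OF J(1)] by blast
    then have "p = emb J z \<or> p = emb (- J) z"
      using \<open>p = emb J w\<close> by (auto simp: emb_uminus_unit)
    then obtain I where I: "I \<in> imag_units" "p = emb I z"
      and I_sing: "pole_sing I A f p \<or> removable_sing I A f p"
      using J uminus_imag_unit [of J] sing_uminus [of J A f p] by metis
    have mem: "w \<in> slice_trace A" if "punctured_disc I p R \<subseteq> A" "w \<noteq> z" "dist w z < R" for w R
      using that mem_punctured_disc_iff [OF I(1), of w z R] emb_mem_iff_slice_trace [OF A(1) I(1)]
      by (auto simp: I(2))
    obtain R where R: "R > 0" "punctured_disc I p R \<subseteq> A"
      using I_sing by (auto simp: pole_sing_def removable_sing_def singularity_in_def)
    have ev: "\<forall>\<^sub>F w in at z. w \<in> slice_trace A"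
      unfolding eventually_at using R mem by blast
    have "F holomorphic_on ball z R - {z}"
      by (rule holomorphic_on_subset [OF hol])
        (use mem [OF R(2)] in \<open>simp add: subset_iff dist_commute\<close>)
    then have iso: "isolated_singularity_at F z"
      using R(1) by (intro isolated_singularity_at_holomorphic [of _ "ball z R"]) auto
    from I_sing have "F meromorphic_on {z}"
    proof
      assume "removable_sing I A f p"
      then obtain U g where "open U" "p \<in> U" "regular_on U g" "\<And>q. q \<in> U \<inter> A \<Longrightarrow> g q = f q"
        by (auto simp: removable_sing_def removable_at_def)
      then obtain G where G: "G analytic_on {z}" "\<forall>\<^sub>F w in at z. G w = F w"
        using removable_imp_meromorphic [OF A(1) F I(1) ev] I(2) by metis
      then have "G meromorphic_on {z}"
        by (intro analytic_on_imp_meromorphic_on)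
      then show ?thesis
        using meromorphic_on_cong [of "{z}" G F "{z}"] G(2) by simp
    next
      assume "pole_sing I A f p"
      then obtain R a l where R: "R > 0" "punctured_disc I p R \<subseteq> A"
        and sum: "\<And>q. q \<in> punctured_disc I p R \<Longrightarrow> ((\<lambda>n. (q - p) powi n * a n) has_sum f q) UNIV"
        and a: "\<And>n. n > l \<Longrightarrow> a (- n) = 0"
        unfolding pole_sing_def by blast
      interpret sc: bounded_linear "slice_coord I"
        by (rule bounded_linear_slice_coord)
      show ?thesis
      proof (rule laurent_has_sum_imp_meromorphic [OF R(1) _ _ iso])
        show "slice_coord I (a n) = 0" if "n < - l" for n
          using a [of "- n"] that by (simp add: sc.zero)
        fix w assume w: "w \<noteq> z" "dist w z < R"
        have "((\<lambda>n. slice_coord I ((emb I w - p) powi n * a n)) has_sum slice_coord I (f (emb I w))) UNIV"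
          using sum [of "emb I w"] w mem_punctured_disc_iff [OF I(1)] I(2)
          by (intro has_sum_bounded_linear [OF bounded_linear_slice_coord]) simp
        moreover have "slice_coord I ((emb I w - p) powi n * a n) = (w - z) powi n * slice_coord I (a n)" for n
          using slice_coord_emb_mult [OF I(1), of "(w - z) powi n" "a n"]
          by (simp add: I(2) emb_powi [OF I(1)])
        moreover have "f (emb I w) = emb I (F w)"
          using stemD [OF F I(1)] mem [OF R(2) w] by simp
        ultimately show "((\<lambda>n. (w - z) powi n * slice_coord I (a n)) has_sum F w) UNIV"
          using I(1) by simp
      qed
    qed
    with ev show ?thesis by simp
  qed
  then have "meromorphic_stem D A f F"
    unfolding meromorphic_stem_def using A F hol by (subst meromorphic_on_meromorphic_at) blast
  then show ?thesis
    by (rule that)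
qed

text \<open>
  At a missing point the Laurent expansion of the stem function is embedded into the slice, where
  it has a finite principal part. Hence the point is a pole as soon as it is not removable.
\<close>
lemma meromorphic_stem_imp_semireg_pairs:
  assumes D: "symmetric_slice_domain D" and st: "meromorphic_stem D A f F"
  shows "(A, f) \<in> semireg_pairs D"
proof -
  have A: "symmetric_slice_domain A" "A \<subseteq> D" and F: "stem A f F"
    and hol: "F holomorphic_on slice_trace A" and mero: "F meromorphic_on slice_trace D"
    and ev: "\<And>z. z \<in> slice_trace D \<Longrightarrow> \<forall>\<^sub>F w in at z. w \<in> slice_trace A"
    using st by (auto simp: meromorphic_stem_def)
  have "\<exists>I\<in>imag_units. pole_sing I A f p \<or> removable_sing I A f p" if p: "p \<in> D - A" for p
  proof -
    obtain I where I: "I \<in> imag_units" and pI: "p = emb I (sphere_coord p)"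
      by (rule ex_unit_sphere_coord)
    define z where "z = sphere_coord p"
    have pz: "p = emb I z"
      using pI by (simp add: z_def)
    have z: "z \<in> slice_trace D"
      using p pz emb_mem_iff_slice_trace [OF D I] by simp
    have disc: "punctured_disc I p R \<subseteq> A"
      if "\<And>w. \<lbrakk>w \<noteq> z; dist w z < R\<rbrakk> \<Longrightarrow> w \<in> slice_trace A" for R
    proof
      fix q assume q: "q \<in> punctured_disc I p R"
      then obtain w where w: "q = emb I w"
        by (auto simp: punctured_disc_def mem_slice_iff)
      show "q \<in> A"
        using q that mem_punctured_disc_iff [OF I] emb_mem_iff_slice_trace [OF A(1) I]
        by (simp add: w pz)
    qed
    obtain r where r: "r > 0" "\<And>w. \<lbrakk>w \<noteq> z; dist w z < r\<rbrakk> \<Longrightarrow> w \<in> slice_trace A"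
      using ev [OF z] unfolding eventually_at by blast
    have sing: "singularity_in I A p"
      unfolding singularity_in_def using r disc [of r] by (auto simp: pz)
    have "F meromorphic_on {z}"
      using mero z meromorphic_on_subset by blast
    then obtain R N c where R: "R > 0" and c: "\<forall>n<N. c n = 0"
      and sum: "\<forall>w. w \<noteq> z \<and> dist w z < R \<longrightarrow> ((\<lambda>n::int. (w - z) powi n * c n) has_sum F w) UNIV"
      by (rule meromorphic_imp_laurent_has_sum)
    define R' where "R' = min r R"
    have "((\<lambda>n. (q - p) powi n * emb I (c n)) has_sum f q) UNIV" if q: "q \<in> punctured_disc I p R'" for q
    proof -
      obtain w where w: "q = emb I w"
        using q by (auto simp: punctured_disc_def mem_slice_iff)
      have w': "w \<noteq> z" "dist w z < r" "dist w z < R"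
        using q mem_punctured_disc_iff [OF I, of w z R'] by (simp_all add: w pz R'_def)
      have "((\<lambda>n. emb I ((w - z) powi n * c n)) has_sum emb I (F w)) UNIV"
        using sum [rule_format, OF conjI [OF w'(1,3)]] by (rule has_sum_bounded_linear [OF bounded_linear_emb [OF I]])
      moreover have "emb I (F w) = f q"
        using stemD [OF F I r(2) [OF w'(1,2)]] by (simp add: w)
      ultimately show ?thesis
        by (simp add: w pz emb_mult [OF I] emb_powi [OF I])
    qed
    moreover have "R' > 0"
      using r R by (simp add: R'_def)
    moreover have "punctured_disc I p R' \<subseteq> A"
      by (rule disc) (rule r(2); simp add: R'_def)
    moreover have "\<forall>n>max 0 (- N). emb I (c (- n)) = 0"
      using c by simp
    moreover have "max 0 (- N) \<ge> 0"
      by simp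
    ultimately have "\<exists>R>0. \<exists>a. punctured_disc I p R \<subseteq> A \<and>
        (\<forall>q\<in>punctured_disc I p R. ((\<lambda>n. (q - p) powi n * a n) has_sum f q) UNIV) \<and>
        (\<exists>l\<ge>0. \<forall>n>l. a (- n) = 0)"
      by (intro exI [of _ R'] conjI exI [of _ "\<lambda>n. emb I (c n)"] exI [of _ "max 0 (- N)"] ballI)
    then have "pole_sing I A f p" if "\<not> removable_at A f p"
      unfolding pole_sing_def using sing that by blast
    then show ?thesis
      unfolding removable_sing_def using sing I by blast
  qed
  moreover have "slice_preserving_on A f"
    using stem_imp_slice_preserving [OF A(1) F hol] .
  ultimately show ?thesis
    using A by (simp add: semireg_pairs_def)
qed

section \<open>The multiplicative group of semiregular functions\<close>

lemma semireg_pairs_iff: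
  assumes "symmetric_slice_domain D"
  shows "(A, f) \<in> semireg_pairs D \<longleftrightarrow> (\<exists>F. meromorphic_stem D A f F)"
  using semireg_pairs_imp_meromorphic_stem [OF assms] meromorphic_stem_imp_semireg_pairs [OF assms]
  by metis

lemma meromorphic_stemD:
  assumes "meromorphic_stem D A f F"
  shows "symmetric_slice_domain A" "A \<subseteq> D" "stem A f F" "F holomorphic_on slice_trace A"
    "F meromorphic_on slice_trace D" "\<And>z. z \<in> slice_trace D \<Longrightarrow> \<forall>\<^sub>F w in at z. w \<in> slice_trace A"
  using assms by (auto simp: meromorphic_stem_def)

text \<open>
  Agreement on the common domain follows from agreement near every point by continuity. The right
  hand side does not mention the domains, so transitivity of the relation is immediate from it.
\<close>
lemma semireg_rel_iff:
  assumes D: "symmetric_slice_domain D"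
    and F: "meromorphic_stem D A f F" and G: "meromorphic_stem D B g G"
  shows "((A, f), (B, g)) \<in> semireg_rel D \<longleftrightarrow> (\<forall>z\<in>slice_trace D. \<forall>\<^sub>F w in at z. F w = G w)"
proof -
  note f = meromorphic_stemD [OF F] and g = meromorphic_stemD [OF G]
  have "(\<forall>q\<in>A \<inter> B. f q = g q) \<longleftrightarrow> (\<forall>z\<in>slice_trace D. \<forall>\<^sub>F w in at z. F w = G w)"
  proof (intro iffI ballI)
    fix z assume eq: "\<forall>q\<in>A \<inter> B. f q = g q" and z: "z \<in> slice_trace D"
    show "\<forall>\<^sub>F w in at z. F w = G w"
      using f(6) [OF z] g(6) [OF z]
    proof eventually_elim
      case (elim w)
      then have "f (emb quat_i w) = g (emb quat_i w)"
        using eq by (auto simp: slice_trace_def)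
      then show "F w = G w"
        using elim stemD [OF f(3) quat_ij_units(1)] stemD [OF g(3) quat_ij_units(1)]
        by (simp add: emb_eq_iff)
    qed
  next
    fix q assume ev: "\<forall>z\<in>slice_trace D. \<forall>\<^sub>F w in at z. F w = G w" and q: "q \<in> A \<inter> B"
    obtain I z where I: "I \<in> imag_units" and qz: "q = emb I z"
      using ex_unit_sphere_coord by metis
    have z: "z \<in> slice_trace A" "z \<in> slice_trace B"
      using q qz emb_mem_iff_slice_trace [OF f(1) I] emb_mem_iff_slice_trace [OF g(1) I] by auto
    then have "z \<in> slice_trace D"
      using f(2) by (auto simp: slice_trace_def)
    then have e: "\<forall>\<^sub>F w in at z. F w = G w"
      using ev by blast
    have "isCont F z" "isCont G z"
      using f(4) g(4) z open_slice_trace [OF f(1)] open_slice_trace [OF g(1)]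
      by (auto dest!: holomorphic_on_imp_continuous_on simp: continuous_on_eq_continuous_at)
    then have "(F \<longlongrightarrow> F z) (at z)" "(G \<longlongrightarrow> G z) (at z)"
      by (simp_all add: isCont_def)
    then have "F z = G z"
      using tendsto_cong [OF e] tendsto_unique [of "at z"] by (metis at_neq_bot)
    then show "f q = g q"
      using stemD [OF f(3) I z(1)] stemD [OF g(3) I z(2)] qz by simp
  qed
  moreover have "(A, f) \<in> semireg_pairs D" "(B, g) \<in> semireg_pairs D"
    using meromorphic_stem_imp_semireg_pairs [OF D] F G by auto
  ultimately show ?thesis
    by (simp add: semireg_rel_def)
qed

lemma equiv_semireg_rel:
  assumes D: "symmetric_slice_domain D"
  shows "equiv (semireg_pairs D) (semireg_rel D)"
proof (rule equivI)
  show "semireg_rel D \<subseteq> semireg_pairs D \<times> semireg_pairs D"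
    by (auto simp: semireg_rel_def)
  show "refl_on (semireg_pairs D) (semireg_rel D)"
    by (auto simp: refl_on_def semireg_rel_def)
  show "sym (semireg_rel D)"
    by (auto simp: sym_def semireg_rel_def)
  show "trans (semireg_rel D)"
  proof (rule transI)
    fix x y z assume xy: "(x, y) \<in> semireg_rel D" and yz: "(y, z) \<in> semireg_rel D"
    obtain A f B g C h where xyz: "x = (A, f)" "y = (B, g)" "z = (C, h)"
      by (metis surj_pair)
    have "(A, f) \<in> semireg_pairs D" "(B, g) \<in> semireg_pairs D" "(C, h) \<in> semireg_pairs D"
      using xy yz by (auto simp: semireg_rel_def xyz)
    then obtain F G K where st: "meromorphic_stem D A f F" "meromorphic_stem D B g G"
      "meromorphic_stem D C h K"
      unfolding semireg_pairs_iff [OF D] by blast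
    have "\<forall>\<^sub>F w in at u. F w = K w" if "u \<in> slice_trace D" for u
    proof -
      have "\<forall>\<^sub>F w in at u. F w = G w" "\<forall>\<^sub>F w in at u. G w = K w"
        using xy yz that semireg_rel_iff [OF D st(1,2)] semireg_rel_iff [OF D st(2,3)]
        unfolding xyz by blast+
      then show ?thesis
        by eventually_elim simp
    qed
    then show "(x, z) \<in> semireg_rel D"
      unfolding xyz using semireg_rel_iff [OF D st(1,3)] by blast
  qed
qed

lemma semireg_class_eq_iff:
  assumes D: "symmetric_slice_domain D"
    and "meromorphic_stem D A f F" "meromorphic_stem D B g G"
  shows "semireg_class D A f = semireg_class D B g \<longleftrightarrow>
    (\<forall>z\<in>slice_trace D. \<forall>\<^sub>F w in at z. F w = G w)"
proof -
  have "(A, f) \<in> semireg_pairs D" "(B, g) \<in> semireg_pairs D"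
    using meromorphic_stem_imp_semireg_pairs [OF D] assms by blast+
  then show ?thesis
    unfolding semireg_class_def semireg_rel_iff [OF assms, symmetric]
    by (rule eq_equiv_class_iff [OF equiv_semireg_rel [OF D]])
qed

text \<open>
  The complement of \<open>S\<close> in the plane domain is closed and discrete there. It therefore neither
  disconnects the domain nor contains all real points near a given one.
\<close>
lemma symmetric_slice_domain_cofinite:
  assumes D: "symmetric_slice_domain D"
    and S: "open S" "S \<subseteq> slice_trace D" "\<And>z. z \<in> S \<Longrightarrow> cnj z \<in> S"
    and ev: "\<And>z. z \<in> slice_trace D \<Longrightarrow> \<forall>\<^sub>F w in at z. w \<in> S"
  shows "symmetric_slice_domain (circularization S)"
proof -
  have op: "open (slice_trace D)" and con: "connected (slice_trace D)"
    using open_slice_trace [OF D] connected_slice_trace [OF D] .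
  have "(slice_trace D - S) sparse_in slice_trace D"
    unfolding sparse_in_eventually_iff [OF op]
  proof
    fix z assume "z \<in> slice_trace D"
    from ev [OF this] show "\<forall>\<^sub>F w in at z. w \<notin> slice_trace D - S"
      by eventually_elim simp
  qed
  then have "connected (slice_trace D - (slice_trace D - S))"
    using op con by (intro sparse_imp_connected) simp_all
  moreover have "slice_trace D - (slice_trace D - S) = S"
    using S(2) by blast
  ultimately have "connected S"
    by simp
  obtain x where x: "complex_of_real x \<in> slice_trace D"
    using real_point_slice_trace [OF D] .
  have "complex_of_real x islimpt slice_trace D \<inter> \<real>"
    using islimpt_reals [OF op x] .
  moreover obtain T where T: "open T" "complex_of_real x \<in> T" "\<And>w. \<lbrakk>w \<in> T; w \<noteq> complex_of_real x\<rbrakk> \<Longrightarrow> w \<in> S"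
    using ev [OF x] unfolding eventually_at_topological by blast
  ultimately obtain w where "w \<in> slice_trace D \<inter> \<real>" "w \<in> T" "w \<noteq> complex_of_real x"
    using islimptE by metis
  then have "w \<in> S" "w \<in> \<real>"
    using T(3) by auto
  then obtain t where "complex_of_real t \<in> S"
    by (metis Reals_cases)
  then show ?thesis
    using symmetric_slice_domain_circularization [OF S(1) \<open>connected S\<close> S(3)] by blast
qed

lemma meromorphic_stem_mult:
  assumes D: "symmetric_slice_domain D"
    and F: "meromorphic_stem D A f F" and G: "meromorphic_stem D B g G"
  shows "meromorphic_stem D (A \<inter> B) (\<lambda>q. f q * g q) (\<lambda>z. F z * G z)"
proof -
  note f = meromorphic_stemD [OF F] and g = meromorphic_stemD [OF G]
  have tr: "slice_trace (A \<inter> B) = slice_trace A \<inter> slice_trace B"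
    by (auto simp: slice_trace_def)
  have ev: "\<forall>\<^sub>F w in at z. w \<in> slice_trace A \<inter> slice_trace B" if "z \<in> slice_trace D" for z
    using f(6) [OF that] g(6) [OF that] by eventually_elim simp
  have "symmetric_slice_domain (circularization (slice_trace A \<inter> slice_trace B))"
  proof (rule symmetric_slice_domain_cofinite [OF D])
    show "open (slice_trace A \<inter> slice_trace B)"
      using open_slice_trace f(1) g(1) by blast
    show "slice_trace A \<inter> slice_trace B \<subseteq> slice_trace D"
      using f(2) by (auto simp: slice_trace_def)
  qed (use ev cnj_mem_slice_trace f(1) g(1) in auto)
  moreover have "circularization (slice_trace A \<inter> slice_trace B) = A \<inter> B"
    using circularization_slice_trace [OF f(1)] circularization_slice_trace [OF g(1)]
    by (auto simp: circularization_def)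
  ultimately have "symmetric_slice_domain (A \<inter> B)"
    by simp
  moreover have "stem (A \<inter> B) (\<lambda>q. f q * g q) (\<lambda>z. F z * G z)"
    using f(3) g(3) by (simp add: stem_def tr emb_mult)
  moreover have "(\<lambda>z. F z * G z) holomorphic_on slice_trace (A \<inter> B)"
    unfolding tr by (intro holomorphic_on_mult holomorphic_on_subset [OF f(4)] holomorphic_on_subset [OF g(4)]) auto
  moreover have "(\<lambda>z. F z * G z) meromorphic_on slice_trace D"
    using f(5) g(5) by (rule meromorphic_on_mult)
  ultimately show ?thesis
    unfolding meromorphic_stem_def tr using ev f(2) by blast
qed

text \<open>
  An instance of the identity theorem; it makes \<open>Ms D\<close> free of zero divisors.
\<close>
lemma meromorphic_stem_dichotomy:
  assumes D: "symmetric_slice_domain D" and F: "meromorphic_stem D A f F"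
  shows "(\<forall>z\<in>slice_trace D. \<forall>\<^sub>F w in at z. F w = 0) \<or> (\<forall>z\<in>slice_trace D. \<forall>\<^sub>F w in at z. F w \<noteq> 0)"
  using meromorphic_imp_constant_or_avoid [OF meromorphic_stemD(5) [OF F] open_slice_trace [OF D]
      connected_slice_trace [OF D], of 0] eventually_cosparse_imp_eventually_at
  by fastforce

text \<open>
  For negative exponents the zeros of \<open>f\<close> become singularities and have to be taken out of its
  domain. They are isolated by the hypothesis on \<open>F\<close>.
\<close>
lemma meromorphic_stem_powi:
  assumes D: "symmetric_slice_domain D" and F: "meromorphic_stem D A f F"
    and nz: "\<And>z. z \<in> slice_trace D \<Longrightarrow> \<forall>\<^sub>F w in at z. F w \<noteq> 0"
  obtains B where "meromorphic_stem D B (\<lambda>q. f q powi n) (\<lambda>z. F z powi n)"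
proof -
  note f = meromorphic_stemD [OF F]
  define S where "S = {z \<in> slice_trace A. F z \<noteq> 0}"
  define B where "B = circularization S"
  have "S = slice_trace A \<inter> F -` (- {0})"
    by (auto simp: S_def)
  then have opS: "open S"
    using holomorphic_on_imp_continuous_on [OF f(4)] open_slice_trace [OF f(1)]
    by (metis (no_types, lifting) continuous_on_open_vimage open_Compl closed_singleton Int_commute)
  have symS: "cnj z \<in> S" if "z \<in> S" for z
    using that cnj_mem_slice_trace [OF f(1)] stem_cnj [OF f(1,3)] by (simp add: S_def)
  have SD: "S \<subseteq> slice_trace D"
    using f(2) by (auto simp: S_def slice_trace_def)
  have ev: "\<forall>\<^sub>F w in at z. w \<in> S" if "z \<in> slice_trace D" for z
    using nz [OF that] f(6) [OF that] by eventually_elim (simp add: S_def)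
  have trB: "slice_trace B = S"
    unfolding B_def using symS by (rule slice_trace_circularization)
  have B: "symmetric_slice_domain B"
    unfolding B_def using D opS SD symS ev by (rule symmetric_slice_domain_cofinite)
  have "B \<subseteq> D"
    using circularization_slice_trace [OF D] SD unfolding B_def circularization_def by blast
  moreover have "stem B (\<lambda>q. f q powi n) (\<lambda>z. F z powi n)"
    using f(3) by (auto simp: stem_def trB S_def emb_powi)
  moreover have "(\<lambda>z. F z powi n) holomorphic_on slice_trace B"
    unfolding trB by (intro holomorphic_on_power_int holomorphic_on_subset [OF f(4)]) (auto simp: S_def)
  moreover have "(\<lambda>z. F z powi n) meromorphic_on slice_trace D"
    using f(5) by (rule meromorphic_on_powi)
  ultimately have "meromorphic_stem D B (\<lambda>q. f q powi n) (\<lambda>z. F z powi n)"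
    unfolding meromorphic_stem_def trB using B ev by blast
  then show ?thesis
    by (rule that)
qed

lemma meromorphic_stem_const:
  assumes D: "symmetric_slice_domain D"
  shows "meromorphic_stem D D (\<lambda>q. of_real r) (\<lambda>z. of_real r)"
proof -
  have "\<forall>\<^sub>F w in at z. w \<in> slice_trace D" if "z \<in> slice_trace D" for z
    using open_slice_trace [OF D] that by (rule eventually_at_in_open')
  then show ?thesis
    using D meromorphic_on_const by (simp add: meromorphic_stem_def stem_def)
qed

definition represents ::
    "quat set \<Rightarrow> semireg \<Rightarrow> quat set \<Rightarrow> (quat \<Rightarrow> quat) \<Rightarrow> (complex \<Rightarrow> complex) \<Rightarrow> bool" where
  "represents D \<Phi> A f F \<longleftrightarrow> meromorphic_stem D A f F \<and> \<Phi> = semireg_class D A f"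

lemma Ms_sel [simp]:
  "carrier (Ms D) = semireg_pairs D // semireg_rel D"
  "\<one>\<^bsub>Ms D\<^esub> = semireg_class D D (\<lambda>q. 1)" "\<zero>\<^bsub>Ms D\<^esub> = semireg_class D D (\<lambda>q. 0)"
  by (simp_all add: Ms_def)

lemma represents_in_carrier:
  assumes "symmetric_slice_domain D" "represents D \<Phi> A f F"
  shows "\<Phi> \<in> carrier (Ms D)"
  using assms meromorphic_stem_imp_semireg_pairs
  by (auto simp: represents_def semireg_class_def intro!: quotientI)

lemma carrier_Ms_represents:
  assumes D: "symmetric_slice_domain D" and "\<Phi> \<in> carrier (Ms D)"
  obtains A f F where "represents D \<Phi> A f F"
proof -
  obtain p where "\<Phi> = semireg_rel D `` {p}" "p \<in> semireg_pairs D"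
    using assms(2) by (auto elim: quotientE)
  then show ?thesis
    using that semireg_pairs_iff [OF D] unfolding represents_def semireg_class_def by (metis surj_pair)
qed

lemma represents_mem_iff:
  assumes D: "symmetric_slice_domain D" and "represents D \<Phi> A f F"
  shows "(B, g) \<in> \<Phi> \<longleftrightarrow> (\<exists>G. represents D \<Phi> B g G)"
proof
  assume "(B, g) \<in> \<Phi>"
  then have rel: "((A, f), (B, g)) \<in> semireg_rel D"
    using assms(2) by (simp add: represents_def semireg_class_def)
  then obtain G where "meromorphic_stem D B g G"
    using semireg_pairs_iff [OF D] by (auto simp: semireg_rel_def)
  moreover have "semireg_class D B g = \<Phi>"
    using assms(2) equiv_class_eq [OF equiv_semireg_rel [OF D] rel]
    by (simp add: represents_def semireg_class_def)
  ultimately show "\<exists>G. represents D \<Phi> B g G"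
    by (auto simp: represents_def)
next
  assume "\<exists>G. represents D \<Phi> B g G"
  then show "(B, g) \<in> \<Phi>"
    using equiv_class_self [OF equiv_semireg_rel [OF D]] meromorphic_stem_imp_semireg_pairs [OF D]
    by (auto simp: represents_def semireg_class_def)
qed

lemma represents_eq_iff:
  assumes "symmetric_slice_domain D" "represents D \<Phi> A f F" "represents D \<Psi> B g G"
  shows "\<Phi> = \<Psi> \<longleftrightarrow> (\<forall>z\<in>slice_trace D. \<forall>\<^sub>F w in at z. F w = G w)"
  using assms semireg_class_eq_iff unfolding represents_def by blast

lemma represents_zero_one:
  assumes "symmetric_slice_domain D"
  shows "represents D \<zero>\<^bsub>Ms D\<^esub> D (\<lambda>q. 0) (\<lambda>z. 0)" "represents D \<one>\<^bsub>Ms D\<^esub> D (\<lambda>q. 1) (\<lambda>z. 1)"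
  using meromorphic_stem_const [OF assms, of 0] meromorphic_stem_const [OF assms, of 1]
  by (simp_all add: represents_def)

text \<open>
  The product in \<open>Ms D\<close> is a union over all representatives of both factors, and every choice of
  representatives contributes the same class.
\<close>
lemma represents_mult:
  assumes D: "symmetric_slice_domain D"
    and F: "represents D \<Phi> A f F" and G: "represents D \<Psi> B g G"
  shows "represents D (\<Phi> \<otimes>\<^bsub>Ms D\<^esub> \<Psi>) (A \<inter> B) (\<lambda>q. f q * g q) (\<lambda>z. F z * G z)"
proof -
  let ?C = "semireg_class D (A \<inter> B) (\<lambda>q. f q * g q)"
  have const: "semireg_class D (A' \<inter> B') (\<lambda>q. f' q * g' q) = ?C"
    if mem: "(A', f') \<in> \<Phi>" "(B', g') \<in> \<Psi>" for A' f' B' g'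
  proof -
    obtain F' G' where F': "represents D \<Phi> A' f' F'" and G': "represents D \<Psi> B' g' G'"
      using mem represents_mem_iff [OF D F] represents_mem_iff [OF D G] by blast
    have "\<forall>\<^sub>F w in at z. F' w * G' w = F w * G w" if "z \<in> slice_trace D" for z
    proof -
      have "\<forall>\<^sub>F w in at z. F' w = F w" "\<forall>\<^sub>F w in at z. G' w = G w"
        using represents_eq_iff [OF D F' F] represents_eq_iff [OF D G' G] that by auto
      then show ?thesis
        by eventually_elim simp
    qed
    moreover have "meromorphic_stem D A f F" "meromorphic_stem D B g G"
      "meromorphic_stem D A' f' F'" "meromorphic_stem D B' g' G'"
      using F G F' G' by (simp_all add: represents_def)
    ultimately show ?thesis
      using semireg_class_eq_iff [OF D meromorphic_stem_mult [OF D] meromorphic_stem_mult [OF D]]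
      by blast
  qed
  have "\<Phi> \<noteq> {}" "\<Psi> \<noteq> {}"
    using represents_mem_iff [OF D F] represents_mem_iff [OF D G] F G by blast+
  have "(\<Union>p\<in>\<Phi>. \<Union>r\<in>\<Psi>. semireg_class D (fst p \<inter> fst r) (\<lambda>q. snd p q * snd r q))
      = (\<Union>p\<in>\<Phi>. \<Union>r\<in>\<Psi>. ?C)"
    by (intro SUP_cong refl const; simp only: prod.collapse)
  also have "\<dots> = ?C"
    using \<open>\<Phi> \<noteq> {}\<close> \<open>\<Psi> \<noteq> {}\<close> by simp
  finally have "\<Phi> \<otimes>\<^bsub>Ms D\<^esub> \<Psi> = ?C"
    by (simp add: Ms_def case_prod_unfold)
  then show ?thesis
    using meromorphic_stem_mult [OF D] F G by (simp add: represents_def)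
qed

lemma represents_nonzero_iff:
  assumes D: "symmetric_slice_domain D" and F: "represents D \<Phi> A f F"
  shows "\<Phi> \<noteq> \<zero>\<^bsub>Ms D\<^esub> \<longleftrightarrow> (\<forall>z\<in>slice_trace D. \<forall>\<^sub>F w in at z. F w \<noteq> 0)"
proof -
  have eq: "\<Phi> = \<zero>\<^bsub>Ms D\<^esub> \<longleftrightarrow> (\<forall>z\<in>slice_trace D. \<forall>\<^sub>F w in at z. F w = 0)"
    using represents_eq_iff [OF D F represents_zero_one(1) [OF D]] .
  obtain x where x: "complex_of_real x \<in> slice_trace D"
    using real_point_slice_trace [OF D] .
  have "\<not> (\<forall>\<^sub>F w in at (complex_of_real x). F w = 0)" if "\<forall>\<^sub>F w in at (complex_of_real x). F w \<noteq> 0"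
    using that eventually_happens [OF eventually_conj [OF that]] by auto
  then show ?thesis
    using eq x meromorphic_stem_dichotomy [OF D] F unfolding represents_def by blast
qed

lemma group_mult_of_Ms:
  assumes D: "symmetric_slice_domain D"
  shows "group (mult_of (Ms D))"
proof (rule groupI)
  note ex = carrier_Ms_represents [OF D]
  note nz = represents_nonzero_iff [OF D]
  fix \<Phi> assume "\<Phi> \<in> carrier (mult_of (Ms D))"
  then have \<Phi>: "\<Phi> \<in> carrier (Ms D)" "\<Phi> \<noteq> \<zero>\<^bsub>Ms D\<^esub>"
    by auto
  then obtain A f F where F: "represents D \<Phi> A f F"
    using ex by blast
  have Fnz: "\<forall>\<^sub>F w in at z. F w \<noteq> 0" if "z \<in> slice_trace D" for z
    using \<Phi>(2) nz [OF F] that by blast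
  show "\<one>\<^bsub>mult_of (Ms D)\<^esub> \<otimes>\<^bsub>mult_of (Ms D)\<^esub> \<Phi> = \<Phi>"
    using represents_eq_iff [OF D represents_mult [OF D represents_zero_one(2) [OF D] F] F] by simp
  show "\<exists>\<Psi>\<in>carrier (mult_of (Ms D)). \<Psi> \<otimes>\<^bsub>mult_of (Ms D)\<^esub> \<Phi> = \<one>\<^bsub>mult_of (Ms D)\<^esub>"
  proof -
    have "meromorphic_stem D A f F"
      using F by (simp add: represents_def)
    then obtain B where "meromorphic_stem D B (\<lambda>q. f q powi (- 1)) (\<lambda>z. F z powi (- 1))"
      using Fnz by (rule meromorphic_stem_powi [OF D])
    then obtain \<Psi> where \<Psi>: "represents D \<Psi> B (\<lambda>q. inverse (f q)) (\<lambda>z. inverse (F z))"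
      by (auto simp: represents_def power_int_minus)
    have "\<forall>\<^sub>F w in at z. inverse (F w) \<noteq> 0" if "z \<in> slice_trace D" for z
      using Fnz [OF that] by eventually_elim simp
    then have "\<Psi> \<in> carrier (mult_of (Ms D))"
      using represents_in_carrier [OF D \<Psi>] nz [OF \<Psi>] by simp
    moreover have "\<forall>\<^sub>F w in at z. inverse (F w) * F w = 1" if "z \<in> slice_trace D" for z
      using Fnz [OF that] by eventually_elim simp
    then have "\<Psi> \<otimes>\<^bsub>Ms D\<^esub> \<Phi> = \<one>\<^bsub>Ms D\<^esub>"
      using represents_eq_iff [OF D represents_mult [OF D \<Psi> F] represents_zero_one(2) [OF D]] by blast
    ultimately show ?thesis by auto
  qed
  fix \<Psi> assume "\<Psi> \<in> carrier (mult_of (Ms D))"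
  then have \<Psi>: "\<Psi> \<in> carrier (Ms D)" "\<Psi> \<noteq> \<zero>\<^bsub>Ms D\<^esub>"
    by auto
  then obtain B g G where G: "represents D \<Psi> B g G"
    using ex by blast
  have Gnz: "\<forall>\<^sub>F w in at z. G w \<noteq> 0" if "z \<in> slice_trace D" for z
    using \<Psi>(2) nz [OF G] that by blast
  have "\<forall>\<^sub>F w in at z. F w * G w \<noteq> 0" if "z \<in> slice_trace D" for z
    using Fnz [OF that] Gnz [OF that] by eventually_elim simp
  then show "\<Phi> \<otimes>\<^bsub>mult_of (Ms D)\<^esub> \<Psi> \<in> carrier (mult_of (Ms D))"
    using represents_mult [OF D F G] represents_in_carrier [OF D] nz by simp
  fix \<Theta> assume "\<Theta> \<in> carrier (mult_of (Ms D))"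
  then have "\<Theta> \<in> carrier (Ms D)"
    by auto
  then obtain C h K where K: "represents D \<Theta> C h K"
    using ex by blast
  have "\<Phi> \<otimes>\<^bsub>Ms D\<^esub> \<Psi> \<otimes>\<^bsub>Ms D\<^esub> \<Theta> = \<Phi> \<otimes>\<^bsub>Ms D\<^esub> (\<Psi> \<otimes>\<^bsub>Ms D\<^esub> \<Theta>)"
    using represents_eq_iff [OF D represents_mult [OF D represents_mult [OF D F G] K]
        represents_mult [OF D F represents_mult [OF D G K]]]
    by (simp add: mult.assoc)
  then show "\<Phi> \<otimes>\<^bsub>mult_of (Ms D)\<^esub> \<Psi> \<otimes>\<^bsub>mult_of (Ms D)\<^esub> \<Theta>
      = \<Phi> \<otimes>\<^bsub>mult_of (Ms D)\<^esub> (\<Psi> \<otimes>\<^bsub>mult_of (Ms D)\<^esub> \<Theta>)"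
    by simp
next
  have "\<one>\<^bsub>Ms D\<^esub> \<noteq> \<zero>\<^bsub>Ms D\<^esub>"
    using represents_nonzero_iff [OF D represents_zero_one(2) [OF D]] by simp
  then show "\<one>\<^bsub>mult_of (Ms D)\<^esub> \<in> carrier (mult_of (Ms D))"
    using represents_in_carrier [OF D represents_zero_one(2) [OF D]] by simp
qed

section \<open>Filling in removable singularities\<close>

lemma emb_eq_emb_cases:
  assumes "I \<in> imag_units" "J \<in> imag_units" "emb I z = emb J w"
  obtains "z = w" "Im w = 0" | "z = w" "I = J" | "z = cnj w" "I = - J"
proof -
  have c: "Re z = Re w" "qim1 I * Im z = qim1 J * Im w" "qim2 I * Im z = qim2 J * Im w"
    "qim3 I * Im z = qim3 J * Im w"
    using arg_cong [OF assms(3), of qre] arg_cong [OF assms(3), of qim1]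
      arg_cong [OF assms(3), of qim2] arg_cong [OF assms(3), of qim3] assms(1,2)
    by (simp_all add: emb_components)
  have "\<bar>Im z\<bar> = \<bar>Im w\<bar>"
    using sphere_coord_emb [OF assms(1), of z] sphere_coord_emb [OF assms(2), of w] assms(3) by simp
  moreover have "qre I = 0" "qre J = 0"
    using assms by (simp_all add: imag_units_iff)
  moreover have "qim1 I = s * qim1 J \<and> qim2 I = s * qim2 J \<and> qim3 I = s * qim3 J"
    if "Im z = s * Im w" "Im w \<noteq> 0" "s * s = 1" for s
  proof -
    have "u = s * v" if "u * Im z = v * Im w" for u v
    proof -
      have "(s * u) * Im w = v * Im w"
        using that \<open>Im z = s * Im w\<close> by (simp only: ac_simps)
      then have "s * (s * u) = s * v"
        using \<open>Im w \<noteq> 0\<close> by simp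
      then show ?thesis
        using \<open>s * s = 1\<close> by (simp only: mult.assoc [symmetric] mult_1)
    qed
    then show ?thesis
      using c by blast
  qed
  from this [of 1] this [of "- 1"]
  have "Im w \<noteq> 0 \<Longrightarrow> Im z = Im w \<Longrightarrow> qim1 I = qim1 J \<and> qim2 I = qim2 J \<and> qim3 I = qim3 J"
    "Im w \<noteq> 0 \<Longrightarrow> Im z = - Im w \<Longrightarrow> qim1 I = - qim1 J \<and> qim2 I = - qim2 J \<and> qim3 I = - qim3 J"
    by simp_all
  ultimately consider "Im z = Im w" "Im w = 0" | "Im z = Im w" "I = J" | "Im z = - Im w" "I = - J"
    unfolding quat_eq_iff abs_eq_iff by fastforce
  then show ?thesis
    using that c(1) by cases (auto simp: complex_eq_iff)
qed

text \<open>
  A point off the real axis is \<open>emb I z\<close> for two pairs \<open>(I, z)\<close>, related by negating \<open>I\<close> and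
  conjugating \<open>z\<close>; a real point is \<open>emb I z\<close> for every \<open>I\<close>. The symmetry of \<open>G\<close> makes the value
  independent of the choice, in the real case because it forces \<open>G z\<close> to be real.
\<close>
lemma ex_stem:
  assumes "\<And>z. z \<in> S \<Longrightarrow> cnj z \<in> S" "\<And>z. z \<in> S \<Longrightarrow> G (cnj z) = cnj (G z)"
  obtains g where "\<forall>I\<in>imag_units. \<forall>z\<in>S. g (emb I z) = emb I (G z)"
proof
  define g where "g = (\<lambda>q. SOME v. \<exists>I\<in>imag_units. \<exists>z\<in>S. q = emb I z \<and> v = emb I (G z))"
  show "\<forall>I\<in>imag_units. \<forall>z\<in>S. g (emb I z) = emb I (G z)"
  proof (intro ballI)
    fix I z assume I: "I \<in> imag_units" and z: "z \<in> S"
    then have "\<exists>v. \<exists>J\<in>imag_units. \<exists>w\<in>S. emb I z = emb J w \<and> v = emb J (G w)"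
      by blast
    then have "\<exists>J\<in>imag_units. \<exists>w\<in>S. emb I z = emb J w \<and> g (emb I z) = emb J (G w)"
      unfolding g_def by (rule someI_ex)
    then obtain J w where J: "J \<in> imag_units" and w: "w \<in> S"
      and eq: "emb I z = emb J w" and v: "g (emb I z) = emb J (G w)"
      by blast
    from I J eq have "emb J (G w) = emb I (G z)"
    proof (cases rule: emb_eq_emb_cases)
      case 1
      then have "cnj w = w"
        by (simp add: complex_eq_iff)
      then have "cnj (G w) = G w"
        using assms(2) [OF w] by simp
      then have "G w = of_real (Re (G w))"
        by (simp add: complex_eq_iff)
      then show ?thesis
        using 1 by (metis emb_simps(3))
    next
      case 3
      then show ?thesis
        using assms(2) [OF w] by (simp add: emb_uminus_unit)
    qed simp
    with v show "g (emb I z) = emb I (G z)"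
      by simp
  qed
qed

lemma slice_trace_mono: "A \<subseteq> D \<Longrightarrow> slice_trace A \<subseteq> slice_trace D"
  by (auto simp: slice_trace_def)

lemma stem_limit_cnj:
  assumes D: "symmetric_slice_domain D" and F: "meromorphic_stem D A f F"
    and z: "z \<in> slice_trace D" and lim: "F \<midarrow>z\<rightarrow> c"
  shows "F \<midarrow>cnj z\<rightarrow> cnj c"
proof -
  note f = meromorphic_stemD [OF F]
  have "(cnj \<longlongrightarrow> cnj (cnj z)) (at (cnj z))"
    by (intro tendsto_cnj tendsto_ident_at)
  moreover have "\<forall>\<^sub>F w in at (cnj z). cnj w \<noteq> z"
    using eventually_neq_at_within [of "cnj z"] by eventually_elim auto
  ultimately have "filterlim cnj (at z) (at (cnj z))"
    by (simp add: filterlim_at)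
  then have "((\<lambda>w. F (cnj w)) \<longlongrightarrow> c) (at (cnj z))"
    by (rule filterlim_compose [OF lim])
  then have "((\<lambda>w. cnj (F (cnj w))) \<longlongrightarrow> cnj c) (at (cnj z))"
    by (rule tendsto_cnj)
  moreover have "\<forall>\<^sub>F w in at (cnj z). cnj (F (cnj w)) = F w"
    using f(6) [OF cnj_mem_slice_trace [OF D z]]
    by eventually_elim (simp add: stem_cnj [OF f(1,3)])
  ultimately show ?thesis
    by (rule Lim_transform_eventually)
qed

lemma not_pole_iff_limit:
  assumes "F meromorphic_on {z}"
  shows "\<not> is_pole F z \<longleftrightarrow> (\<exists>c. F \<midarrow>z\<rightarrow> c)"
proof -
  have "not_essential F z"
    using assms by (rule meromorphic_on_not_essential)
  then show ?thesis
    unfolding not_essential_def is_pole_def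
    using not_tendsto_and_filterlim_at_infinity [of "at z" F] by auto
qed

text \<open>
  The representative with the largest domain: it consists of all points that are not poles of the
  stem function. This set is conjugation invariant because limits of \<open>F\<close> can be conjugated.
\<close>
lemma fill_in_removable:
  assumes D: "symmetric_slice_domain D" and F: "meromorphic_stem D A f F"
  obtains B g where "meromorphic_stem D B g (remove_sings F)"
    "slice_trace B = {z \<in> slice_trace D. \<not> is_pole F z}"
proof -
  note f = meromorphic_stemD [OF F]
  define T where "T = {z \<in> slice_trace D. \<not> is_pole F z}"
  define B where "B = circularization T"
  define G where "G = remove_sings F"
  have mero: "F meromorphic_on {z}" if "z \<in> slice_trace D" for z
    using f(5) that meromorphic_on_subset by blast
  have T_iff: "z \<in> T \<longleftrightarrow> z \<in> slice_trace D \<and> (\<exists>c. F \<midarrow>z\<rightarrow> c)" for z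
    using not_pole_iff_limit [OF mero] by (auto simp: T_def)
  have symT: "cnj z \<in> T" if "z \<in> T" for z
    using that stem_limit_cnj [OF D F] cnj_mem_slice_trace [OF D] unfolding T_iff by blast
  have symG: "G (cnj z) = cnj (G z)" if z: "z \<in> T" for z
  proof -
    obtain c where c: "F \<midarrow>z\<rightarrow> c" "z \<in> slice_trace D"
      using z T_iff by blast
    then show ?thesis
      using stem_limit_cnj [OF D F c(2,1)] by (simp add: G_def remove_sings_eqI)
  qed
  have AT: "slice_trace A \<subseteq> T"
  proof
    fix z assume z: "z \<in> slice_trace A"
    have "F analytic_on {z}"
      using f(4) z open_slice_trace [OF f(1)] by (auto simp: analytic_at)
    then show "z \<in> T"
      using z slice_trace_mono [OF f(2)] analytic_at_imp_no_pole by (auto simp: T_def)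
  qed
  have evT: "\<forall>\<^sub>F w in at z. w \<in> T" if "z \<in> slice_trace D" for z
    using f(6) [OF that] AT by (auto elim!: eventually_mono)
  have opT: "open T"
  proof (rule Topological_Spaces.openI)
    fix z assume z: "z \<in> T"
    then have "z \<in> slice_trace D"
      by (simp add: T_def)
    from evT [OF this] obtain U where U: "open U" "z \<in> U" "\<forall>w\<in>U. w \<noteq> z \<longrightarrow> w \<in> T"
      unfolding eventually_at_topological by blast
    have "U \<subseteq> T"
    proof
      fix w assume "w \<in> U"
      then show "w \<in> T"
        using U(3) z by (cases "w = z") simp_all
    qed
    with U(1,2) show "\<exists>U. open U \<and> z \<in> U \<and> U \<subseteq> T"
      by blast
  qed
  have TD: "T \<subseteq> slice_trace D"
    by (auto simp: T_def)
  have B: "symmetric_slice_domain B"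
    unfolding B_def using D opT TD symT evT by (rule symmetric_slice_domain_cofinite)
  have trB: "slice_trace B = T"
    unfolding B_def using symT by (rule slice_trace_circularization)
  have "B \<subseteq> D"
    using circularization_slice_trace [OF D] TD unfolding B_def circularization_def by blast
  obtain g where "\<forall>I\<in>imag_units. \<forall>z\<in>T. g (emb I z) = emb I (G z)"
    by (rule ex_stem [of T G]) (use symT symG in blast)+
  then have "stem B g G"
    by (simp add: stem_def trB)
  moreover have "G holomorphic_on slice_trace B"
  proof (rule analytic_imp_holomorphic, subst analytic_on_analytic_at, intro ballI)
    fix z assume "z \<in> slice_trace B"
    then obtain c where "z \<in> slice_trace D" "F \<midarrow>z\<rightarrow> c"
      using T_iff trB by blast
    then show "G analytic_on {z}"
      unfolding G_def using mero by (intro remove_sings_analytic_at meromorphic_on_isolated_singularity)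
  qed
  moreover have "G meromorphic_on slice_trace D"
    unfolding G_def using f(5) by (rule remove_sings_meromorphic)
  ultimately have "meromorphic_stem D B g G"
    unfolding meromorphic_stem_def trB using B \<open>B \<subseteq> D\<close> evT by blast
  then show ?thesis
    using trB unfolding G_def T_def by (rule that)
qed

lemma eventually_remove_sings_eq_stem:
  assumes "meromorphic_stem D A f F" "z \<in> slice_trace D"
  shows "\<forall>\<^sub>F w in at z. remove_sings F w = F w"
  using meromorphic_stemD(5) [OF assms(1)] assms(2)
  by (intro eventually_remove_sings_eq_at meromorphic_on_isolated_singularity)
    (auto intro: meromorphic_on_subset)

section \<open>The spherical order\<close>

text \<open>
  The stem function of \<open>sphere_poly x y\<close>.
\<close>
definition sphere_stem :: "real \<Rightarrow> real \<Rightarrow> complex \<Rightarrow> complex" where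
  "sphere_stem x y z = (if y = 0 then z - of_real x else (z - of_real x)\<^sup>2 + (of_real y)\<^sup>2)"

lemma sphere_poly_emb:
  assumes "I \<in> imag_units"
  shows "sphere_poly x y (emb I z) = emb I (sphere_stem x y z)"
proof -
  have "emb I ((of_real y)\<^sup>2) = (of_real y)\<^sup>2"
    using emb_simps(3) [of I "y\<^sup>2"] by simp
  then show ?thesis
    by (simp add: sphere_poly_def sphere_stem_def emb_power [OF assms])
qed

lemma sphere_stem_eq:
  "y \<noteq> 0 \<Longrightarrow> sphere_stem x y z = (z - Complex x y) * (z - cnj (Complex x y))"
  by (simp add: sphere_stem_def complex_eq_iff power2_eq_square algebra_simps)

lemma sphere_stem_eq_0_iff: "sphere_stem x y z = 0 \<longleftrightarrow> z = Complex x y \<or> z = cnj (Complex x y)"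
proof (cases "y = 0")
  case True
  then show ?thesis
    by (auto simp: sphere_stem_def complex_eq_iff)
next
  case False
  then show ?thesis
    using sphere_stem_eq [of y x z] by simp
qed

lemma eventually_sphere_stem_nonzero: "\<forall>\<^sub>F w in at z. sphere_stem x y w \<noteq> 0"
proof -
  have "\<forall>\<^sub>F w in at z. w \<noteq> Complex x y" "\<forall>\<^sub>F w in at z. w \<noteq> cnj (Complex x y)"
    by (simp_all add: eventually_neq_at_within)
  then show ?thesis
    by eventually_elim (simp add: sphere_stem_eq_0_iff)
qed

lemma holomorphic_sphere_stem: "sphere_stem x y holomorphic_on S"
  unfolding sphere_stem_def by (cases "y = 0") (auto intro!: holomorphic_intros)

lemma zorder_sphere_stem:
  assumes "z = Complex x y \<or> z = cnj (Complex x y)"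
  shows "zorder (sphere_stem x y) z = 1"
proof (cases "y = 0")
  case True
  then have "z = of_real x"
    using assms by (auto simp: complex_eq_iff)
  then show ?thesis
    using True by (intro zorder_eqI [of UNIV z "\<lambda>_. 1"]) (auto simp: sphere_stem_def)
next
  case False
  show ?thesis
  proof (rule zorder_eqI [of UNIV z "\<lambda>w. w - cnj z"])
    show "z - cnj z \<noteq> 0"
      using assms False by (auto simp: complex_eq_iff)
    show "sphere_stem x y w = (w - cnj z) * (w - z) powi 1" for w
      using assms sphere_stem_eq [OF False, of x w] by (auto simp: mult.commute)
  qed (auto intro!: holomorphic_intros)
qed

lemma meromorphic_stem_sphere_poly:
  assumes D: "symmetric_slice_domain D"
  shows "meromorphic_stem D D (sphere_poly x y) (sphere_stem x y)"
proof -
  have "\<forall>\<^sub>F w in at z. w \<in> slice_trace D" if "z \<in> slice_trace D" for z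
    using open_slice_trace [OF D] that by (rule eventually_at_in_open')
  moreover have "sphere_stem x y meromorphic_on slice_trace D"
    using holomorphic_sphere_stem [of x y UNIV]
    by (intro analytic_on_imp_meromorphic_on) (meson analytic_on_holomorphic open_UNIV subset_UNIV)
  ultimately show ?thesis
    using D by (simp add: meromorphic_stem_def stem_def sphere_poly_emb holomorphic_sphere_stem)
qed

text \<open>
  The factorization that defines the spherical order becomes \<open>F = P\<^sup>l G\<close> near \<open>z\<close>, where \<open>P\<close> has a
  simple zero at \<open>z\<close> and \<open>G\<close> is holomorphic and nonzero there.
\<close>
lemma is_sord_imp_zorder:
  assumes D: "symmetric_slice_domain D" and F: "represents D \<Phi> A f F"
    and I: "I \<in> imag_units" and z: "z \<in> slice_trace D" and sord: "is_sord D \<Phi> (emb I z) l"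
  shows "zorder F z = l"
proof -
  obtain J x y A' f' B g where J: "J \<in> imag_units" "emb I z = spt J x y"
    and A': "(A', f') \<in> \<Phi>" and B: "(B, g) \<in> semireg_pairs D"
    and sph: "sphere_at x y \<subseteq> B" "\<And>q. q \<in> sphere_at x y \<Longrightarrow> g q \<noteq> 0"
    and eq: "\<And>q. q \<in> A' \<inter> B - sphere_at x y \<Longrightarrow> f' q = sphere_poly x y q powi l * g q"
    using sord unfolding is_sord_def by blast
  have xy: "emb I u \<in> sphere_at x y \<longleftrightarrow> u = Complex x y \<or> u = cnj (Complex x y)" for u
    using emb_mem_sphere_at_iff [OF I, of u "Complex x y"] by simp
  have zs: "emb I z \<in> sphere_at x y"
    using J by (auto simp: sphere_at_def)
  obtain F' where F': "represents D \<Phi> A' f' F'"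
    using A' represents_mem_iff [OF D F] by blast
  obtain G where G: "meromorphic_stem D B g G"
    using B semireg_pairs_iff [OF D] by blast
  note f = meromorphic_stemD [of D A' f' F'] and g = meromorphic_stemD [OF G]
  have mF': "meromorphic_stem D A' f' F'"
    using F' by (simp add: represents_def)
  have zB: "z \<in> slice_trace B"
    using zs sph(1) emb_mem_iff_slice_trace [OF g(1) I] by blast
  then have anG: "G analytic_on {z}"
    using g(4) open_slice_trace [OF g(1)] by (auto simp: analytic_at)
  have Gz: "G z \<noteq> 0"
    using sph(2) [OF zs] stemD [OF g(3) I zB] by auto
  have evG: "\<forall>\<^sub>F w in at z. G w \<noteq> 0"
    using anG Gz by (metis analytic_at_imp_isCont continuous_at_imp_continuous_at_within
        continuous_within tendsto_imp_eventually_ne)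
  let ?P = "sphere_stem x y"
  have mP: "?P meromorphic_on {z}"
    by (rule analytic_on_imp_meromorphic_on) (use holomorphic_sphere_stem analytic_at in blast)
  have evP: "\<forall>\<^sub>F w in at z. ?P w powi l \<noteq> 0"
    using eventually_sphere_stem_nonzero [of x y z] by eventually_elim simp
  have "\<forall>\<^sub>F w in at z. F' w = F w"
    using represents_eq_iff [OF D F' F] z by blast
  then have "\<forall>\<^sub>F w in at z. F w = ?P w powi l * G w"
    using f(6) [OF mF' z] g(6) [OF z] eventually_sphere_stem_nonzero [of x y z]
  proof eventually_elim
    case (elim w)
    then have "emb I w \<in> A' \<inter> B - sphere_at x y"
      using xy sphere_stem_eq_0_iff emb_mem_iff_slice_trace [OF _ I] f(1) [OF mF'] g(1) by blast
    from eq [OF this] have "emb I (F' w) = emb I (?P w powi l * G w)"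
      using elim stemD [OF f(3) [OF mF'] I] stemD [OF g(3) I]
      by (simp add: sphere_poly_emb [OF I] emb_mult [OF I] emb_powi [OF I])
    then show ?case
      using elim by (simp add: emb_eq_iff [OF I])
  qed
  then have "zorder F z = zorder (\<lambda>w. ?P w powi l * G w) z"
    by (intro zorder_cong) auto
  also have "\<dots> = zorder (\<lambda>w. ?P w powi l) z + zorder G z"
    using analytic_on_imp_meromorphic_on [OF anG] meromorphic_on_powi [OF mP] evP evG
    by (intro zorder_mult eventually_frequently) simp_all
  also have "zorder (\<lambda>w. ?P w powi l) z = l * zorder ?P z"
    using mP eventually_sphere_stem_nonzero by (intro zorder_power_int eventually_frequently) auto
  also have "zorder ?P z = 1"
    using zs xy by (intro zorder_sphere_stem) blast
  also have "zorder G z = 0"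
    using anG Gz by (rule zorder_eq_0I)
  finally show ?thesis
    by simp
qed

text \<open>
  The quotient of \<open>F\<close> by the power of the sphere polynomial has order zero at \<open>z\<close>, so its singularity
  at \<open>z\<close>, and at the conjugate point, is removable. Filling in all removable singularities yields
  the factor \<open>g\<close>, whose value on the sphere is not zero.
\<close>
lemma is_sord_zorder:
  assumes D: "symmetric_slice_domain D" and F: "represents D \<Phi> A f F" and nz: "\<Phi> \<noteq> \<zero>\<^bsub>Ms D\<^esub>"
    and I: "I \<in> imag_units" and z: "z \<in> slice_trace D"
  shows "is_sord D \<Phi> (emb I z) (zorder F z)"
proof -
  define x where "x = Re z"
  define y where "y = Im z"
  have zxy: "z = Complex x y"
    by (simp add: x_def y_def)
  define l where "l = zorder F z"
  let ?P = "sphere_stem x y"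
  have mF: "meromorphic_stem D A f F"
    using F by (simp add: represents_def)
  note f = meromorphic_stemD [OF mF]
  have evF: "\<forall>\<^sub>F w in at z. F w \<noteq> 0"
    using represents_nonzero_iff [OF D F] nz z by blast
  obtain C where C: "meromorphic_stem D C (\<lambda>q. sphere_poly x y q powi (- l)) (\<lambda>w. ?P w powi (- l))"
    using meromorphic_stem_powi [OF D meromorphic_stem_sphere_poly [OF D] eventually_sphere_stem_nonzero] .
  define K where "K = (\<lambda>w. F w * ?P w powi (- l))"
  have mK: "meromorphic_stem D (A \<inter> C) (\<lambda>q. f q * sphere_poly x y q powi (- l)) K"
    unfolding K_def using meromorphic_stem_mult [OF D mF C] .
  have Kz: "K meromorphic_on {z}"
    using meromorphic_stemD(5) [OF mK] z meromorphic_on_subset by blast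
  have evK: "\<forall>\<^sub>F w in at z. K w \<noteq> 0"
    using evF eventually_sphere_stem_nonzero [of x y z] by eventually_elim (simp add: K_def)
  have P: "?P analytic_on {w}" for w
    using holomorphic_sphere_stem analytic_at by blast
  have Fz: "F meromorphic_on {z}"
    using f(5) z meromorphic_on_subset by blast
  have evP: "\<forall>\<^sub>F w in at z. ?P w powi (- l) \<noteq> 0"
    using eventually_sphere_stem_nonzero [of x y z] by eventually_elim simp
  have "zorder K z = zorder F z + zorder (\<lambda>w. ?P w powi (- l)) z"
    unfolding K_def
    using meromorphic_on_powi [OF analytic_on_imp_meromorphic_on [OF P]] Fz evF evP
    by (intro zorder_mult eventually_frequently) simp_all
  also have "zorder (\<lambda>w. ?P w powi (- l)) z = (- l) * zorder ?P z"
    using P eventually_sphere_stem_nonzero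
    by (intro zorder_power_int eventually_frequently analytic_on_imp_meromorphic_on) auto
  also have "zorder ?P z = 1"
    using zxy by (intro zorder_sphere_stem) blast
  finally have zK: "zorder K z = 0"
    by (simp add: l_def)
  have npK: "\<not> is_pole K z"
    using isolated_pole_imp_neg_zorder [OF meromorphic_on_isolated_singularity [OF Kz]] zK by auto
  obtain B g where B: "meromorphic_stem D B g (remove_sings K)"
    and trB: "slice_trace B = {z \<in> slice_trace D. \<not> is_pole K z}"
    using fill_in_removable [OF D mK] .
  note g = meromorphic_stemD [OF B]
  have zB: "z \<in> slice_trace B"
    using trB npK z by blast
  have "remove_sings K analytic_on {z}"
    using g(4) zB open_slice_trace [OF g(1)] by (auto simp: analytic_at)
  moreover have evR: "\<forall>\<^sub>F w in at z. remove_sings K w = K w"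
    using eventually_remove_sings_eq_stem [OF mK z] .
  moreover have "\<exists>\<^sub>F w in at z. remove_sings K w \<noteq> 0"
    using evR evK by (intro eventually_frequently) (auto elim: eventually_elim2)
  moreover have "zorder (remove_sings K) z = 0"
    using zK zorder_cong [OF evR] by simp
  ultimately have Gz: "remove_sings K z \<noteq> 0"
    using zorder_eq_0_iff by blast
  have sphB: "q \<in> B \<and> g q \<noteq> 0" if q: "q \<in> sphere_at x y" for q
  proof -
    obtain J where J: "J \<in> imag_units" "q = emb J z"
      using q by (auto simp: mem_sphere_at_iff zxy)
    then show ?thesis
      using zB stemD [OF g(3) J(1) zB] emb_mem_iff_slice_trace [OF g(1) J(1)] Gz
      by (simp add: emb_eq_0_iff)
  qed
  have "f q = sphere_poly x y q powi l * g q" if q: "q \<in> A \<inter> B - sphere_at x y" for q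
  proof -
    obtain J w where J: "J \<in> imag_units" and w: "q = emb J w"
      using ex_unit_sphere_coord by metis
    have wA: "w \<in> slice_trace A" and wB: "w \<in> slice_trace B"
      using q w emb_mem_iff_slice_trace [OF f(1) J] emb_mem_iff_slice_trace [OF g(1) J] by auto
    have "?P w \<noteq> 0"
      using q w emb_mem_sphere_at_iff [OF J, of w "Complex x y"] by (simp add: sphere_stem_eq_0_iff)
    moreover have "F analytic_on {w}"
      using f(4) wA open_slice_trace [OF f(1)] by (auto simp: analytic_at)
    ultimately have "K analytic_on {w}"
      unfolding K_def using P by (intro analytic_intros) auto
    then have "remove_sings K w = K w"
      by simp
    then have "?P w powi l * remove_sings K w = F w"
      using \<open>?P w \<noteq> 0\<close> by (simp add: K_def power_int_minus)
    then have "emb J (F w) = emb J (?P w) powi l * emb J (remove_sings K w)"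
      by (metis emb_mult emb_powi J)
    then show ?thesis
      using stemD [OF f(3) J wA] stemD [OF g(3) J wB] w by (simp add: sphere_poly_emb [OF J])
  qed
  moreover have "(A, f) \<in> \<Phi>"
    using represents_mem_iff [OF D F] F by blast
  moreover have "(B, g) \<in> semireg_pairs D"
    using meromorphic_stem_imp_semireg_pairs [OF D B] .
  moreover have "emb I z = spt I x y"
    by (simp add: zxy spt_eq_emb)
  ultimately show ?thesis
    unfolding is_sord_def l_def [symmetric] using I sphB by blast
qed

lemma sord_eq_zorder:
  assumes "symmetric_slice_domain D" "represents D \<Phi> A f F" "\<Phi> \<noteq> \<zero>\<^bsub>Ms D\<^esub>"
    and "I \<in> imag_units" "z \<in> slice_trace D"
  shows "sord D \<Phi> (emb I z) = zorder F z"
  unfolding sord_def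
proof (rule the_equality)
  show "is_sord D \<Phi> (emb I z) (zorder F z)"
    by (rule is_sord_zorder [OF assms])
  show "l = zorder F z" if "is_sord D \<Phi> (emb I z) l" for l
    using is_sord_imp_zorder [OF assms(1,2,4,5) that] by simp
qed

section \<open>Spherical divisors\<close>

lemma sphere_at_subset_iff:
  assumes "symmetric_slice_domain D"
  shows "sphere_at x y \<subseteq> D \<longleftrightarrow> Complex x y \<in> slice_trace D"
proof
  assume "sphere_at x y \<subseteq> D"
  moreover have "emb quat_i (Complex x y) \<in> sphere_at x y"
    using quat_ij_units(1) by (auto simp: mem_sphere_at_iff)
  ultimately show "Complex x y \<in> slice_trace D"
    by (auto simp: slice_trace_def)
next
  assume "Complex x y \<in> slice_trace D"
  then show "sphere_at x y \<subseteq> D"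
    using emb_mem_iff_slice_trace [OF assms] by (auto simp: mem_sphere_at_iff)
qed

text \<open>
  Join \<open>z\<close> to a real point by a path. A thin tube around the path, together with its conjugate, is
  connected through the real point. The closed tube \<open>K\<close> is compact and contains only finitely many
  points of a discrete set.
\<close>
lemma sphere_nbhd_finite_support:
  assumes D: "symmetric_slice_domain D" and z: "z \<in> slice_trace D"
    and Z: "Z sparse_in slice_trace D"
  obtains S K where "open S" "connected S" "\<forall>w\<in>S. cnj w \<in> S" "S \<subseteq> slice_trace D" "z \<in> S"
    "S \<inter> \<real> \<noteq> {}" "compact K" "S \<subseteq> K \<union> cnj ` K" "finite (K \<inter> Z)"
proof -
  have op: "open (slice_trace D)"
    using open_slice_trace [OF D] .
  obtain x where x: "complex_of_real x \<in> slice_trace D"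
    using real_point_slice_trace [OF D] .
  have "path_connected (slice_trace D)"
    using connected_open_path_connected [OF op connected_slice_trace [OF D]] .
  then obtain \<gamma> where \<gamma>: "path \<gamma>" "path_image \<gamma> \<subseteq> slice_trace D" "pathstart \<gamma> = z"
    "pathfinish \<gamma> = complex_of_real x"
    using z x unfolding path_connected_def by blast
  define P where "P = path_image \<gamma>"
  have P: "compact P" "connected P" "P \<subseteq> slice_trace D" "z \<in> P" "complex_of_real x \<in> P"
    using \<gamma> compact_path_image [of \<gamma>] connected_path_image [of \<gamma>]
      pathstart_in_path_image [of \<gamma>] pathfinish_in_path_image [of \<gamma>]
    by (simp_all add: P_def)
  obtain e where e: "e > 0" "(\<Union>p\<in>P. ball p e) \<subseteq> slice_trace D"
    using compact_subset_open_imp_ball_epsilon_subset [OF P(1) op P(3)] .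
  define V where "V = (\<Union>p\<in>P. ball p (e / 2))"
  \<comment> \<open>Half the radius, so that the closed tube still lies in the domain.\<close>
  define K where "K = {a + b | a b. a \<in> P \<and> b \<in> cball 0 (e / 2)}"
  have VK: "V \<subseteq> K"
  proof
    fix w assume "w \<in> V"
    then obtain p where p: "p \<in> P" "dist p w < e / 2"
      by (auto simp: V_def)
    then have "w = p + (w - p)" "w - p \<in> cball 0 (e / 2)"
      by (auto simp: dist_norm norm_minus_commute)
    then show "w \<in> K"
      unfolding K_def using p(1) by blast
  qed
  have KD: "K \<subseteq> slice_trace D"
  proof
    fix w assume "w \<in> K"
    then obtain p b where "p \<in> P" "w = p + b" "norm b \<le> e / 2"
      by (auto simp: K_def)
    then have "w \<in> ball p e"
      using e(1) by (simp add: dist_norm)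
    then show "w \<in> slice_trace D"
      using e(2) \<open>p \<in> P\<close> by blast
  qed
  have K: "compact K"
    unfolding K_def using P(1) by (intro compact_sums) auto
  have "V = (\<lambda>(a, b). a + b) ` (P \<times> ball 0 (e / 2))"
  proof
    show "V \<subseteq> (\<lambda>(a, b). a + b) ` (P \<times> ball 0 (e / 2))"
    proof
      fix w assume "w \<in> V"
      then obtain p where p: "p \<in> P" "dist p w < e / 2"
        by (auto simp: V_def)
      then have "(p, w - p) \<in> P \<times> ball 0 (e / 2)"
        by (auto simp: dist_norm norm_minus_commute)
      then show "w \<in> (\<lambda>(a, b). a + b) ` (P \<times> ball 0 (e / 2))"
        by (rule rev_image_eqI) simp
    qed
  qed (auto simp: V_def dist_norm)
  moreover have "connected ((\<lambda>(a, b). a + b) ` (P \<times> ball (0::complex) (e / 2)))"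
    using P(2) by (intro connected_continuous_image connected_Times)
      (auto intro!: continuous_intros simp: case_prod_unfold)
  ultimately have conV: "connected V"
    by simp
  have zV: "z \<in> V" "complex_of_real x \<in> V"
    using P(4,5) e(1) centre_in_ball half_gt_zero unfolding V_def by blast+
  have "cnj ` V = cnj -` V"
    by (auto simp: image_iff) (metis complex_cnj_cnj)
  moreover have opV: "open V"
    by (auto simp: V_def)
  ultimately have opcV: "open (cnj ` V)"
    using open_vimage [of V cnj] continuous_on_cnj [of UNIV "\<lambda>z. z"] by (simp add: id_def)
  define S where "S = V \<union> cnj ` V"
  show ?thesis
  proof
    show "open S"
      unfolding S_def by (rule open_Un [OF opV opcV])
    show "connected S"
      unfolding S_def
    proof (rule connected_Un [OF conV])
      show "connected (cnj ` V)"
        using conV by (rule connected_continuous_image [rotated]) (intro continuous_intros)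
      have "complex_of_real x \<in> cnj ` V"
        using zV(2) by (metis complex_cnj_complex_of_real imageI)
      then show "V \<inter> cnj ` V \<noteq> {}"
        using zV(2) by blast
    qed
    show "\<forall>w\<in>S. cnj w \<in> S"
      by (auto simp: S_def)
    show "S \<subseteq> slice_trace D"
      using VK KD cnj_mem_slice_trace [OF D] by (auto simp: S_def)
    show "z \<in> S"
      using zV by (simp add: S_def)
    show "S \<inter> \<real> \<noteq> {}"
      using zV(2) by (auto simp: S_def)
    show "compact K"
      by (rule K)
    show "S \<subseteq> K \<union> cnj ` K"
      using VK by (auto simp: S_def)
    show "finite (K \<inter> Z)"
      using sparse_in_compact_finite [OF sparse_in_subset [OF Z KD] K] .
  qed
qed

text \<open>
  Local finiteness of the support amounts to discreteness of its trace on one slice. In this form it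
  can be checked at each point separately, without producing symmetric slice domains, and it is
  visibly inherited by sums.
\<close>
lemma spherical_divisor_iff:
  assumes D: "symmetric_slice_domain D"
  shows "spherical_divisor D d \<longleftrightarrow>
    (\<forall>z\<in>slice_trace D. \<forall>I\<in>imag_units. \<forall>J\<in>imag_units. d (emb I z) = d (emb J z)) \<and>
    (\<forall>z\<in>slice_trace D. \<forall>\<^sub>F w in at z. d (emb quat_i w) = 0)"
    (is "_ \<longleftrightarrow> ?const \<and> ?sparse")
proof -
  have const: "(\<forall>S\<in>spheres_of D. \<forall>p\<in>S. \<forall>q\<in>S. d p = d q) \<longleftrightarrow> ?const"
  proof
    assume L: "\<forall>S\<in>spheres_of D. \<forall>p\<in>S. \<forall>q\<in>S. d p = d q"
    show ?const
    proof (intro ballI)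
      fix z I J assume z: "z \<in> slice_trace D" "I \<in> imag_units" "J \<in> imag_units"
      have "sphere_at (Re z) (Im z) \<in> spheres_of D"
        using z(1) sphere_at_subset_iff [OF D, of "Re z" "Im z"] by (auto simp: spheres_of_def)
      moreover have "emb I z \<in> sphere_at (Re z) (Im z)" "emb J z \<in> sphere_at (Re z) (Im z)"
        using z by (simp_all add: emb_mem_sphere_at_iff)
      ultimately show "d (emb I z) = d (emb J z)"
        using L by blast
    qed
  next
    assume R: ?const
    show "\<forall>S\<in>spheres_of D. \<forall>p\<in>S. \<forall>q\<in>S. d p = d q"
    proof (intro ballI)
      fix S p q assume S: "S \<in> spheres_of D" "p \<in> S" "q \<in> S"
      then obtain x y where xy: "S = sphere_at x y" "sphere_at x y \<subseteq> D"
        by (auto simp: spheres_of_def)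
      obtain I J where "I \<in> imag_units" "p = emb I (Complex x y)" "J \<in> imag_units" "q = emb J (Complex x y)"
        using S xy(1) by (auto simp: mem_sphere_at_iff)
      moreover have "Complex x y \<in> slice_trace D"
        using sphere_at_subset_iff [OF D] xy(2) by blast
      ultimately show "d p = d q"
        using R by blast
    qed
  qed
  have "(\<forall>q\<in>D. \<exists>U. q \<in> U \<and> U \<subseteq> D \<and> symmetric_slice_domain U \<and>
      finite {S \<in> spheres_of D. \<exists>p\<in>U \<inter> S. d p \<noteq> 0}) \<longleftrightarrow> ?sparse" if c: ?const
  proof
    assume L: "\<forall>q\<in>D. \<exists>U. q \<in> U \<and> U \<subseteq> D \<and> symmetric_slice_domain U \<and>
      finite {S \<in> spheres_of D. \<exists>p\<in>U \<inter> S. d p \<noteq> 0}"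
    show ?sparse
    proof
      fix z assume z: "z \<in> slice_trace D"
      then have "emb quat_i z \<in> D"
        by (simp add: slice_trace_def)
      then obtain U where U: "emb quat_i z \<in> U" "U \<subseteq> D" "symmetric_slice_domain U"
        and fin: "finite {S \<in> spheres_of D. \<exists>p\<in>U \<inter> S. d p \<noteq> 0}"
        using L by blast
      define \<F> where "\<F> = {S \<in> spheres_of D. \<exists>p\<in>U \<inter> S. d p \<noteq> 0}"
      define Z where "Z = {w \<in> slice_trace U. d (emb quat_i w) \<noteq> 0}"
      have "Z \<subseteq> (\<Union>S\<in>\<F>. {w. emb quat_i w \<in> S})"
      proof
        fix w assume w: "w \<in> Z"
        then have "emb quat_i w \<in> U \<inter> sphere_at (Re w) (Im w)"
          by (simp add: Z_def slice_trace_def emb_mem_sphere_at_iff)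
        moreover have "w \<in> slice_trace D"
          using w slice_trace_mono [OF U(2)] by (auto simp: Z_def)
        then have "sphere_at (Re w) (Im w) \<in> spheres_of D"
          using sphere_at_subset_iff [OF D, of "Re w" "Im w"] by (auto simp: spheres_of_def)
        ultimately show "w \<in> (\<Union>S\<in>\<F>. {w. emb quat_i w \<in> S})"
          using w unfolding \<F>_def Z_def by blast
      qed
      moreover have "finite {w. emb quat_i w \<in> S}" if S: "S \<in> \<F>" for S
      proof -
        obtain x y where "S = sphere_at x y"
          using S by (auto simp: \<F>_def spheres_of_def)
        then have "{w. emb quat_i w \<in> S} = {Complex x y, cnj (Complex x y)}"
          using emb_mem_sphere_at_iff [OF quat_ij_units(1), of _ "Complex x y"] by auto
        then show ?thesis
          by simp
      qed
      ultimately have "finite Z"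
        using fin unfolding \<F>_def [symmetric] by (meson finite_UN_I finite_subset)
      then have "\<forall>\<^sub>F w in at z. w \<notin> Z"
        using islimpt_finite islimpt_iff_eventually by blast
      moreover have "\<forall>\<^sub>F w in at z. w \<in> slice_trace U"
        using open_slice_trace [OF U(3)] U(1) by (intro eventually_at_in_open') (simp_all add: slice_trace_def)
      ultimately show "\<forall>\<^sub>F w in at z. d (emb quat_i w) = 0"
        by eventually_elim (simp add: Z_def)
    qed
  next
    assume sp: ?sparse
    define Z where "Z = {w. d (emb quat_i w) \<noteq> 0}"
    have Z: "Z sparse_in slice_trace D"
      using sp by (simp add: sparse_in_eventually_iff [OF open_slice_trace [OF D]] Z_def)
    show "\<forall>q\<in>D. \<exists>U. q \<in> U \<and> U \<subseteq> D \<and> symmetric_slice_domain U \<and>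
      finite {S \<in> spheres_of D. \<exists>p\<in>U \<inter> S. d p \<noteq> 0}"
    proof
      fix q assume q: "q \<in> D"
      obtain I z where I: "I \<in> imag_units" and qz: "q = emb I z"
        using ex_unit_sphere_coord by metis
      have "z \<in> slice_trace D"
        using q qz emb_mem_iff_slice_trace [OF D I] by simp
      then obtain S K where S: "open S" "connected S" and symS: "\<forall>w\<in>S. cnj w \<in> S"
        and SD: "S \<subseteq> slice_trace D" and zS: "z \<in> S" and real: "S \<inter> \<real> \<noteq> {}"
        and SK: "S \<subseteq> K \<union> cnj ` K" and fin: "finite (K \<inter> Z)"
        using sphere_nbhd_finite_support [OF D _ Z] by metis
      obtain t where t: "complex_of_real t \<in> S"
        using real by (auto elim!: Reals_cases)
      define U where "U = circularization S"
      have U_iff: "emb J w \<in> U \<longleftrightarrow> w \<in> S" if "J \<in> imag_units" for J w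
        unfolding U_def using symS that by (intro emb_mem_circularization_iff) blast
      have "symmetric_slice_domain U"
        unfolding U_def using S symS t by (intro symmetric_slice_domain_circularization) blast+
      moreover have "q \<in> U"
        using U_iff [OF I] zS qz by simp
      moreover have "U \<subseteq> D"
        using circularization_slice_trace [OF D] SD unfolding U_def circularization_def by blast
      moreover
      have "{S \<in> spheres_of D. \<exists>p\<in>U \<inter> S. d p \<noteq> 0} \<subseteq> (\<lambda>w. sphere_at (Re w) (Im w)) ` (K \<inter> Z)"
      proof
        fix T assume "T \<in> {S \<in> spheres_of D. \<exists>p\<in>U \<inter> S. d p \<noteq> 0}"
        then obtain x y p where T: "T = sphere_at x y" "p \<in> U" "p \<in> T" "d p \<noteq> 0"
          by (auto simp: spheres_of_def)
        define w where "w = Complex x y"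
        obtain J where J: "J \<in> imag_units" "p = emb J w"
          using T(1,3) by (auto simp: mem_sphere_at_iff w_def)
        then have wS: "w \<in> S"
          using U_iff T(2) by simp
        obtain u where u: "u \<in> K" "u = w \<or> u = cnj w"
          using SK wS by auto
        have "u \<in> S"
          using u(2) wS symS by auto
        have "p \<in> sphere_at (Re u) (Im u)"
          using J u(2) by (auto simp: emb_mem_sphere_at_iff)
        then obtain L where L: "L \<in> imag_units" "p = emb L u"
          by (auto simp: mem_sphere_at_iff)
        then have "d (emb quat_i u) \<noteq> 0"
          using c T(4) SD \<open>u \<in> S\<close> quat_ij_units(1) by (metis subsetD)
        then have "u \<in> K \<inter> Z"
          using u(1) by (simp add: Z_def)
        moreover have "T = sphere_at (Re u) (Im u)"
          unfolding set_eq_iff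
        proof
          fix r
          obtain M v where M: "M \<in> imag_units" "r = emb M v"
            using ex_unit_sphere_coord by metis
          have "T = sphere_at (Re w) (Im w)"
            by (simp add: T(1) w_def)
          then show "r \<in> T \<longleftrightarrow> r \<in> sphere_at (Re u) (Im u)"
            unfolding M(2) emb_mem_sphere_at_iff [OF M(1)]
            using u(2) emb_mem_sphere_at_iff [OF M(1)] by (metis complex_cnj_cnj)
        qed
        ultimately show "T \<in> (\<lambda>w. sphere_at (Re w) (Im w)) ` (K \<inter> Z)"
          by blast
      qed
      from finite_surj [OF fin this]
      have "finite {S \<in> spheres_of D. \<exists>p\<in>U \<inter> S. d p \<noteq> 0}" .
      ultimately show "\<exists>U. q \<in> U \<and> U \<subseteq> D \<and> symmetric_slice_domain U \<and>
          finite {S \<in> spheres_of D. \<exists>p\<in>U \<inter> S. d p \<noteq> 0}"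
        by (intro exI [of _ U] conjI)
    qed
  qed
  then show ?thesis
    unfolding spherical_divisor_def const by blast
qed

lemma carrier_Div_iff:
  assumes D: "symmetric_slice_domain D"
  shows "(\<lambda>q\<in>D. d q) \<in> carrier (Div D) \<longleftrightarrow>
    (\<forall>z\<in>slice_trace D. \<forall>I\<in>imag_units. \<forall>J\<in>imag_units. d (emb I z) = d (emb J z)) \<and>
    (\<forall>z\<in>slice_trace D. \<forall>\<^sub>F w in at z. d (emb quat_i w) = 0)"
proof -
  have r: "restrict d D (emb I z) = d (emb I z)" if "I \<in> imag_units" "z \<in> slice_trace D" for I z
    using that emb_mem_iff_slice_trace [OF D] by simp
  have r2: "(\<forall>\<^sub>F w in at z. restrict d D (emb quat_i w) = 0) \<longleftrightarrow> (\<forall>\<^sub>F w in at z. d (emb quat_i w) = 0)"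
    if "z \<in> slice_trace D" for z
  proof (rule eventually_subst)
    show "\<forall>\<^sub>F w in at z. (restrict d D (emb quat_i w) = 0) = (d (emb quat_i w) = 0)"
      using eventually_at_in_open' [OF open_slice_trace [OF D] that]
      by eventually_elim (simp only: r quat_ij_units)
  qed
  have const: "(\<forall>z\<in>slice_trace D. \<forall>I\<in>imag_units. \<forall>J\<in>imag_units. restrict d D (emb I z) = restrict d D (emb J z))
      \<longleftrightarrow> (\<forall>z\<in>slice_trace D. \<forall>I\<in>imag_units. \<forall>J\<in>imag_units. d (emb I z) = d (emb J z))"
    by (intro ball_cong refl) (simp only: r)
  have sparse: "(\<forall>z\<in>slice_trace D. \<forall>\<^sub>F w in at z. restrict d D (emb quat_i w) = 0)
      \<longleftrightarrow> (\<forall>z\<in>slice_trace D. \<forall>\<^sub>F w in at z. d (emb quat_i w) = 0)"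
    by (intro ball_cong refl r2)
  show ?thesis
    unfolding Div_def partial_object.simps mem_Collect_eq spherical_divisor_iff [OF D] const sparse
    by (simp only: restrict_extensional simp_thms)
qed

lemma group_Div:
  assumes D: "symmetric_slice_domain D"
  shows "group (Div D)"
proof (rule groupI)
  note iff = carrier_Div_iff [OF D]
  have restr: "restrict d D = d" if "d \<in> carrier (Div D)" for d
    using that by (simp add: Div_def extensional_restrict)
  have sel: "d \<otimes>\<^bsub>Div D\<^esub> e = (\<lambda>q\<in>D. d q + e q)" "\<one>\<^bsub>Div D\<^esub> = (\<lambda>q\<in>D. 0)" for d e
    by (simp_all add: Div_def)
  show "\<one>\<^bsub>Div D\<^esub> \<in> carrier (Div D)"
    unfolding sel iff by simp
  fix d assume d: "d \<in> carrier (Div D)"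
  then have d': "\<forall>z\<in>slice_trace D. \<forall>I\<in>imag_units. \<forall>J\<in>imag_units. d (emb I z) = d (emb J z)"
    "\<And>z. z \<in> slice_trace D \<Longrightarrow> \<forall>\<^sub>F w in at z. d (emb quat_i w) = 0"
    using iff [of d] unfolding restr [OF d] by blast+
  show "\<one>\<^bsub>Div D\<^esub> \<otimes>\<^bsub>Div D\<^esub> d = d"
  proof -
    have "\<one>\<^bsub>Div D\<^esub> \<otimes>\<^bsub>Div D\<^esub> d = restrict d D"
      unfolding sel by (rule restrict_ext) simp
    then show ?thesis
      using restr [OF d] by simp
  qed
  have "\<forall>\<^sub>F w in at z. - d (emb quat_i w) = 0" if "z \<in> slice_trace D" for z
    using d'(2) [OF that] by eventually_elim simp
  then have "(\<lambda>q\<in>D. - d q) \<in> carrier (Div D)"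
    unfolding iff using d'(1) by (metis (no_types, lifting))
  moreover have "(\<lambda>q\<in>D. - d q) \<otimes>\<^bsub>Div D\<^esub> d = \<one>\<^bsub>Div D\<^esub>"
    unfolding sel by (rule restrict_ext) simp
  ultimately show "\<exists>e\<in>carrier (Div D). e \<otimes>\<^bsub>Div D\<^esub> d = \<one>\<^bsub>Div D\<^esub>"
    by blast
  fix e assume e: "e \<in> carrier (Div D)"
  then have e': "\<forall>z\<in>slice_trace D. \<forall>I\<in>imag_units. \<forall>J\<in>imag_units. e (emb I z) = e (emb J z)"
    "\<And>z. z \<in> slice_trace D \<Longrightarrow> \<forall>\<^sub>F w in at z. e (emb quat_i w) = 0"
    using iff [of e] unfolding restr [OF e] by blast+
  have "\<forall>\<^sub>F w in at z. d (emb quat_i w) + e (emb quat_i w) = 0" if "z \<in> slice_trace D" for z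
    using d'(2) [OF that] e'(2) [OF that] by eventually_elim simp
  then show "d \<otimes>\<^bsub>Div D\<^esub> e \<in> carrier (Div D)"
    unfolding sel iff using d'(1) e'(1) by (metis (no_types, lifting))
  fix h assume "h \<in> carrier (Div D)"
  show "d \<otimes>\<^bsub>Div D\<^esub> e \<otimes>\<^bsub>Div D\<^esub> h = d \<otimes>\<^bsub>Div D\<^esub> (e \<otimes>\<^bsub>Div D\<^esub> h)"
    unfolding sel by (rule restrict_ext) simp
qed

lemma principal_div_emb:
  assumes D: "symmetric_slice_domain D" and F: "represents D \<Phi> A f F" "\<Phi> \<noteq> \<zero>\<^bsub>Ms D\<^esub>"
    and "I \<in> imag_units" "z \<in> slice_trace D"
  shows "principal_div D \<Phi> (emb I z) = zorder F z"
  using sord_eq_zorder [OF assms] emb_mem_iff_slice_trace [OF D] assms(4,5)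
  by (simp add: principal_div_def)

lemma group_hom_principal_div:
  assumes D: "symmetric_slice_domain D"
  shows "group_hom (mult_of (Ms D)) (Div D) (principal_div D)"
proof -
  have closed: "principal_div D \<Phi> \<in> carrier (Div D)" if \<Phi>: "\<Phi> \<in> carrier (mult_of (Ms D))" for \<Phi>
  proof -
    have nz: "\<Phi> \<noteq> \<zero>\<^bsub>Ms D\<^esub>" and "\<Phi> \<in> carrier (Ms D)"
      using \<Phi> by auto
    then obtain A f F where F: "represents D \<Phi> A f F"
      using carrier_Ms_represents [OF D] by blast
    then have mF: "meromorphic_stem D A f F"
      by (simp add: represents_def)
    note f = meromorphic_stemD [OF mF]
    have s: "sord D \<Phi> (emb I z) = zorder F z" if "I \<in> imag_units" "z \<in> slice_trace D" for I z
      using sord_eq_zorder [OF D F nz] that .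
    have "\<forall>\<^sub>F w in at z. sord D \<Phi> (emb quat_i w) = 0" if "z \<in> slice_trace D" for z
    proof -
      have "\<forall>\<^sub>F w in at z. F w \<noteq> 0"
        using represents_nonzero_iff [OF D F] nz that by blast
      with f(6) [OF that] show ?thesis
      proof eventually_elim
        case (elim w)
        have "F analytic_on {w}"
          using f(4) elim(1) open_slice_trace [OF f(1)] by (auto simp: analytic_at)
        then have "zorder F w = 0"
          using elim(2) by (rule zorder_eq_0I)
        then show ?case
          using s elim(1) slice_trace_mono [OF f(2)] quat_ij_units(1) by (metis subsetD)
      qed
    qed
    then show ?thesis
      unfolding principal_div_def carrier_Div_iff [OF D] by (simp add: s)
  qed
  have mult: "principal_div D (\<Phi> \<otimes>\<^bsub>Ms D\<^esub> \<Psi>) = (\<lambda>q\<in>D. principal_div D \<Phi> q + principal_div D \<Psi> q)"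
    if \<Phi>: "\<Phi> \<in> carrier (mult_of (Ms D))" and \<Psi>: "\<Psi> \<in> carrier (mult_of (Ms D))" for \<Phi> \<Psi>
  proof -
    have nz: "\<Phi> \<noteq> \<zero>\<^bsub>Ms D\<^esub>" "\<Psi> \<noteq> \<zero>\<^bsub>Ms D\<^esub>" and "\<Phi> \<in> carrier (Ms D)" "\<Psi> \<in> carrier (Ms D)"
      using \<Phi> \<Psi> by auto
    then obtain A f F B g G where F: "represents D \<Phi> A f F" and G: "represents D \<Psi> B g G"
      using carrier_Ms_represents [OF D] by metis
    note FG = represents_mult [OF D F G]
    have "\<Phi> \<otimes>\<^bsub>Ms D\<^esub> \<Psi> \<in> carrier (mult_of (Ms D))"
      using group.is_monoid [OF group_mult_of_Ms [OF D]] monoid.m_closed \<Phi> \<Psi> mult_mult_of by metis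
    then have nz': "\<Phi> \<otimes>\<^bsub>Ms D\<^esub> \<Psi> \<noteq> \<zero>\<^bsub>Ms D\<^esub>"
      by auto
    have "principal_div D (\<Phi> \<otimes>\<^bsub>Ms D\<^esub> \<Psi>) q = principal_div D \<Phi> q + principal_div D \<Psi> q"
      if q: "q \<in> D" for q
    proof -
      obtain I z where I: "I \<in> imag_units" and qz: "q = emb I z"
        using ex_unit_sphere_coord by metis
      have z: "z \<in> slice_trace D"
        using q qz emb_mem_iff_slice_trace [OF D I] by simp
      have m: "F meromorphic_on {z}" "G meromorphic_on {z}"
        using F G z unfolding represents_def
        by (meson empty_subsetI insert_subset meromorphic_on_subset meromorphic_stemD(5))+
      have "\<forall>\<^sub>F w in at z. F w \<noteq> 0" "\<forall>\<^sub>F w in at z. G w \<noteq> 0"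
        using represents_nonzero_iff [OF D F] represents_nonzero_iff [OF D G] nz z by blast+
      then have "zorder (\<lambda>w. F w * G w) z = zorder F z + zorder G z"
        using m by (intro zorder_mult eventually_frequently) simp_all
      then show ?thesis
        unfolding qz principal_div_emb [OF D FG nz' I z] principal_div_emb [OF D F nz(1) I z]
          principal_div_emb [OF D G nz(2) I z] .
    qed
    then show ?thesis
      by (intro extensionalityI [of _ D]) (simp_all add: principal_div_def)
  qed
  have "principal_div D \<in> hom (mult_of (Ms D)) (Div D)"
    unfolding hom_def using closed mult by (simp add: Div_def Pi_def)
  then show ?thesis
    using group_mult_of_Ms [OF D] group_Div [OF D] by (simp add: group_hom_def group_hom_axioms_def)
qed

section \<open>Regular functions and units\<close>

lemma represents_agree:
  assumes "symmetric_slice_domain D" "represents D \<Phi> A f F" "represents D \<Phi> B g G" "q \<in> A \<inter> B"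
  shows "f q = g q"
proof -
  have "((A, f), (B, g)) \<in> semireg_rel D"
    using semireg_rel_iff [OF assms(1)] semireg_class_eq_iff [OF assms(1)] assms(2,3)
    unfolding represents_def by blast
  then show ?thesis
    using assms(4) by (simp add: semireg_rel_def)
qed

text \<open>
  Without negative orders there are no poles, and the representative with the largest domain is
  defined on all of \<open>D\<close>.
\<close>
lemma zorder_nonneg_imp_holomorphic_representative:
  assumes D: "symmetric_slice_domain D" and F: "represents D \<Phi> A f F"
    and nonneg: "\<And>z. z \<in> slice_trace D \<Longrightarrow> 0 \<le> zorder F z"
  obtains g G where "represents D \<Phi> D g G" "\<And>z. z \<in> slice_trace D \<Longrightarrow> zorder G z = zorder F z"
proof -
  have mF: "meromorphic_stem D A f F"
    using F by (simp add: represents_def)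
  obtain B g where B: "meromorphic_stem D B g (remove_sings F)"
    and trB: "slice_trace B = {z \<in> slice_trace D. \<not> is_pole F z}"
    using fill_in_removable [OF D mF] .
  have "\<not> is_pole F z" if "z \<in> slice_trace D" for z
  proof -
    have "isolated_singularity_at F z"
      using meromorphic_stemD(5) [OF mF] that meromorphic_on_subset
      by (intro meromorphic_on_isolated_singularity) blast
    then show ?thesis
      using isolated_pole_imp_neg_zorder nonneg [OF that] by fastforce
  qed
  then have "slice_trace B = slice_trace D"
    using trB by blast
  then have "B = D"
    using circularization_slice_trace [OF D] circularization_slice_trace [OF meromorphic_stemD(1) [OF B]]
    by simp
  have ev: "\<forall>\<^sub>F w in at z. remove_sings F w = F w" if "z \<in> slice_trace D" for z
    using eventually_remove_sings_eq_stem [OF mF that] .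
  have "semireg_class D B g = semireg_class D A f"
    using semireg_class_eq_iff [OF D B mF] ev by blast
  then have "represents D \<Phi> D g (remove_sings F)"
    using F B \<open>B = D\<close> by (simp add: represents_def)
  moreover have "zorder (remove_sings F) z = zorder F z" if "z \<in> slice_trace D" for z
    using zorder_cong [OF ev [OF that]] by simp
  ultimately show ?thesis
    by (rule that)
qed

text \<open>
  A regular extension of \<open>f\<close> to \<open>D\<close> projects to a holomorphic function on one slice. This function
  agrees with the stem function near every point, so the orders are those of a holomorphic function.
\<close>
lemma regular_in_iff:
  assumes D: "symmetric_slice_domain D" and F: "represents D \<Phi> A f F" and nz: "\<Phi> \<noteq> \<zero>\<^bsub>Ms D\<^esub>"
  shows "regular_in D \<Phi> \<longleftrightarrow> (\<forall>z\<in>slice_trace D. 0 \<le> zorder F z)"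
proof
  have mF: "meromorphic_stem D A f F"
    using F by (simp add: represents_def)
  note f = meromorphic_stemD [OF mF]
  assume "regular_in D \<Phi>"
  then obtain h where h: "regular_on D h" "\<And>A f q. (A, f) \<in> \<Phi> \<Longrightarrow> q \<in> A \<Longrightarrow> h q = f q"
    unfolding regular_in_def by blast
  have "(A, f) \<in> \<Phi>"
    using represents_mem_iff [OF D F] F by blast
  define H where "H = (\<lambda>w. slice_coord quat_i (h (emb quat_i w)))"
  have "H holomorphic_on slice_trace D"
    using regular_imp_holomorphic [OF open_of_ssd [OF D] h(1) quat_ij_units(1)]
    by (simp add: H_def slice_trace_def)
  then have H: "H analytic_on {z}" if "z \<in> slice_trace D" for z
    using that open_slice_trace [OF D] by (auto simp: analytic_at)
  show "\<forall>z\<in>slice_trace D. 0 \<le> zorder F z"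
  proof
    fix z assume z: "z \<in> slice_trace D"
    have ev: "\<forall>\<^sub>F w in at z. H w = F w"
      using f(6) [OF z]
    proof eventually_elim
      case (elim w)
      then have "emb quat_i w \<in> A"
        by (simp add: slice_trace_def)
      then have "h (emb quat_i w) = emb quat_i (F w)"
        using h(2) [OF \<open>(A, f) \<in> \<Phi>\<close>] stemD [OF f(3) quat_ij_units(1) elim] by simp
      then show ?case
        by (simp add: H_def)
    qed
    moreover have "\<forall>\<^sub>F w in at z. F w \<noteq> 0"
      using represents_nonzero_iff [OF D F] nz z by blast
    ultimately have "\<forall>\<^sub>F w in at z. H w \<noteq> 0"
      by eventually_elim simp
    then have "0 \<le> zorder H z"
      using H [OF z] by (intro zorder_ge_0 eventually_frequently) simp_all
    then show "0 \<le> zorder F z"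
      using zorder_cong [OF ev] by simp
  qed
next
  assume "\<forall>z\<in>slice_trace D. 0 \<le> zorder F z"
  then obtain g G where g: "represents D \<Phi> D g G"
    using zorder_nonneg_imp_holomorphic_representative [OF D F] by metis
  then have mg: "meromorphic_stem D D g G"
    by (simp add: represents_def)
  have "slice_preserving_on D g"
    using stem_imp_slice_preserving [OF D meromorphic_stemD(3,4) [OF mg]] .
  then have "regular_on D g"
    by (simp add: slice_preserving_on_def)
  moreover have "g q = f' q" if mem: "(A', f') \<in> \<Phi>" "q \<in> A'" for A' f' q
  proof -
    obtain F' where F': "represents D \<Phi> A' f' F'"
      using mem(1) represents_mem_iff [OF D F] by blast
    then have "A' \<subseteq> D"
      by (auto simp: represents_def meromorphic_stem_def)
    then show ?thesis
      using represents_agree [OF D g F'] mem(2) \<open>A' \<subseteq> D\<close> by blast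
  qed
  ultimately show "regular_in D \<Phi>"
    unfolding regular_in_def by blast
qed

lemma Os_carrier_iff:
  assumes D: "symmetric_slice_domain D"
  shows "u \<in> carrier (Os D) \<longleftrightarrow>
    u \<in> extensional D \<and> (\<exists>U. stem D u U \<and> U holomorphic_on slice_trace D)"
  using slice_preserving_imp_stem [OF D, of u] stem_imp_slice_preserving [OF D, of u]
  by (auto simp: Os_def)

lemma holomorphic_stem_imp_meromorphic_stem:
  assumes D: "symmetric_slice_domain D" and "stem D u U" "U holomorphic_on slice_trace D"
  shows "meromorphic_stem D D u U"
proof -
  have "U analytic_on slice_trace D"
    using assms(3) open_slice_trace [OF D] by (simp add: analytic_on_open)
  then show ?thesis
    using assms meromorphic_stemD(6) [OF meromorphic_stem_const [OF D, of 0]]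
    by (simp add: meromorphic_stem_def analytic_on_imp_meromorphic_on)
qed

text \<open>
  A unit has no zeros, so the orders of its stem function vanish. Conversely, if all orders vanish,
  the holomorphic representative has no zeros and its pointwise inverse is slice preserving regular.
\<close>
lemma unit_in_Os_iff:
  assumes D: "symmetric_slice_domain D" and F: "represents D \<Phi> A f F" and nz: "\<Phi> \<noteq> \<zero>\<^bsub>Ms D\<^esub>"
  shows "unit_in_Os D \<Phi> \<longleftrightarrow> (\<forall>z\<in>slice_trace D. zorder F z = 0)"
proof
  assume "unit_in_Os D \<Phi>"
  then obtain u where u: "u \<in> Units (Os D)" and \<Phi>: "\<Phi> = semireg_class D D u"
    by (auto simp: unit_in_Os_def)
  then obtain v where uv: "u \<otimes>\<^bsub>Os D\<^esub> v = \<one>\<^bsub>Os D\<^esub>"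
    unfolding Units_def by blast
  have "u \<in> carrier (Os D)"
    using u by (simp add: Units_def)
  then obtain U where U: "stem D u U" "U holomorphic_on slice_trace D"
    using Os_carrier_iff [OF D] by blast
  have repU: "represents D \<Phi> D u U"
    unfolding represents_def using holomorphic_stem_imp_meromorphic_stem [OF D U] \<Phi> by simp
  show "\<forall>z\<in>slice_trace D. zorder F z = 0"
  proof
    fix z assume z: "z \<in> slice_trace D"
    then have q: "emb quat_i z \<in> D"
      by (simp add: slice_trace_def)
    have "u (emb quat_i z) * v (emb quat_i z) = 1"
      using fun_cong [OF uv, of "emb quat_i z"] q by (simp add: Os_def)
    then have "U z \<noteq> 0"
      using stemD [OF U(1) quat_ij_units(1) z] by auto
    moreover have "U analytic_on {z}"
      using U(2) z open_slice_trace [OF D] by (auto simp: analytic_at)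
    ultimately have "zorder U z = 0"
      by (intro zorder_eq_0I)
    moreover have "\<forall>\<^sub>F w in at z. U w = F w"
      using represents_eq_iff [OF D repU F] z by blast
    ultimately show "zorder F z = 0"
      using zorder_cong by metis
  qed
next
  assume z0: "\<forall>z\<in>slice_trace D. zorder F z = 0"
  then obtain g G where g: "represents D \<Phi> D g G"
    and G0: "\<And>z. z \<in> slice_trace D \<Longrightarrow> zorder G z = zorder F z"
    using zorder_nonneg_imp_holomorphic_representative [OF D F] by (metis order_refl)
  then have mg: "meromorphic_stem D D g G"
    by (simp add: represents_def)
  note g' = meromorphic_stemD [OF mg]
  have Gnz: "G z \<noteq> 0" if z: "z \<in> slice_trace D" for z
  proof -
    have "G analytic_on {z}"
      using g'(4) z open_slice_trace [OF D] by (auto simp: analytic_at)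
    moreover have "\<forall>\<^sub>F w in at z. G w \<noteq> 0"
      using represents_nonzero_iff [OF D g] nz z by blast
    ultimately show ?thesis
      using zorder_eq_0_iff [of G z] G0 [OF z] z0 z eventually_frequently [of "at z"] by simp
  qed
  define u where "u = (\<lambda>q\<in>D. g q)"
  define v where "v = (\<lambda>q\<in>D. inverse (g q))"
  have mem: "emb I z \<in> D" if "I \<in> imag_units" "z \<in> slice_trace D" for I z
    using that emb_mem_iff_slice_trace [OF D] by blast
  have su: "stem D u G"
    using g'(3) mem by (simp add: stem_def u_def)
  have sv: "stem D v (\<lambda>z. inverse (G z))"
    using g'(3) mem by (simp add: stem_def v_def emb_inverse)
  have "(\<lambda>z. inverse (G z)) holomorphic_on slice_trace D"
    using g'(4) Gnz by (intro holomorphic_on_inverse) auto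
  then have v: "v \<in> carrier (Os D)"
    unfolding Os_carrier_iff [OF D] using sv by (auto simp: v_def)
  have u: "u \<in> carrier (Os D)"
    unfolding Os_carrier_iff [OF D] using su g'(4) by (auto simp: u_def)
  have "g q \<noteq> 0" if q: "q \<in> D" for q
  proof -
    obtain I z where I: "I \<in> imag_units" and qz: "q = emb I z"
      using ex_unit_sphere_coord by metis
    have z: "z \<in> slice_trace D"
      using q qz emb_mem_iff_slice_trace [OF D I] by simp
    then show ?thesis
      using stemD [OF g'(3) I z] Gnz [OF z] qz by (simp add: emb_eq_0_iff [OF I])
  qed
  then have "u \<otimes>\<^bsub>Os D\<^esub> v = \<one>\<^bsub>Os D\<^esub>" "v \<otimes>\<^bsub>Os D\<^esub> u = \<one>\<^bsub>Os D\<^esub>"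
    unfolding Os_def u_def v_def monoid.simps ring_record_simps by (intro restrict_ext; simp)+
  then have "u \<in> Units (Os D)"
    using u v unfolding Units_def by blast
  moreover have "\<Phi> = semireg_class D D u"
    using semireg_class_eq_iff [OF D mg holomorphic_stem_imp_meromorphic_stem [OF D su g'(4)]] g
    by (simp add: represents_def)
  ultimately show "unit_in_Os D \<Phi>"
    unfolding unit_in_Os_def by blast
qed

lemma ball_domain_iff_ball_trace:
  assumes "symmetric_slice_domain D" "\<And>I z. \<lbrakk>I \<in> imag_units; z \<in> slice_trace D\<rbrakk> \<Longrightarrow> d (emb I z) = e z"
  shows "(\<forall>q\<in>D. P (d q)) \<longleftrightarrow> (\<forall>z\<in>slice_trace D. P (e z))"
proof
  assume "\<forall>q\<in>D. P (d q)"
  then show "\<forall>z\<in>slice_trace D. P (e z)"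
    using assms(2) [OF quat_ij_units(1)] by (auto simp: slice_trace_def)
next
  assume R: "\<forall>z\<in>slice_trace D. P (e z)"
  show "\<forall>q\<in>D. P (d q)"
  proof
    fix q assume "q \<in> D"
    moreover obtain I z where I: "I \<in> imag_units" and qz: "q = emb I z"
      using ex_unit_sphere_coord by metis
    ultimately show "P (d q)"
      using R assms(2) emb_mem_iff_slice_trace [OF assms(1)] by simp
  qed
qed

theorem lemma3p25:
  fixes D :: "quat set"
  assumes "symmetric_slice_domain D"
  shows "group_hom (mult_of (Ms D)) (Div D) (principal_div D) \<and>
         (\<forall>F\<in>carrier (mult_of (Ms D)).
            regular_in D F \<longleftrightarrow> (\<forall>q\<in>D. 0 \<le> principal_div D F q)) \<and>
         (\<forall>F\<in>carrier (mult_of (Ms D)).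
            unit_in_Os D F \<longleftrightarrow> principal_div D F = \<one>\<^bsub>Div D\<^esub>)"
proof (intro conjI ballI)
  show "group_hom (mult_of (Ms D)) (Div D) (principal_div D)"
    using group_hom_principal_div [OF assms] .
  fix \<Phi> assume "\<Phi> \<in> carrier (mult_of (Ms D))"
  then have nz: "\<Phi> \<noteq> \<zero>\<^bsub>Ms D\<^esub>" and "\<Phi> \<in> carrier (Ms D)"
    by auto
  then obtain A f F where F: "represents D \<Phi> A f F"
    using carrier_Ms_represents [OF assms] by blast
  have iff: "(\<forall>q\<in>D. P (principal_div D \<Phi> q)) \<longleftrightarrow> (\<forall>z\<in>slice_trace D. P (zorder F z))" for P
    using ball_domain_iff_ball_trace [where e = "zorder F", OF assms principal_div_emb [OF assms F nz]] .
  show "regular_in D \<Phi> \<longleftrightarrow> (\<forall>q\<in>D. 0 \<le> principal_div D \<Phi> q)"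
    unfolding regular_in_iff [OF assms F nz] iff ..
  have "principal_div D \<Phi> = \<one>\<^bsub>Div D\<^esub> \<longleftrightarrow> (\<forall>q\<in>D. principal_div D \<Phi> q = 0)"
    by (auto simp: Div_def principal_div_def fun_eq_iff)
  then show "unit_in_Os D \<Phi> \<longleftrightarrow> principal_div D \<Phi> = \<one>\<^bsub>Div D\<^esub>"
    unfolding unit_in_Os_iff [OF assms F nz] iff [of "\<lambda>n. n = 0"] by simp
qed

end
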